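(* For every fixed integer $k \ge 0$, as $n \to \infty$, \[ N_{\rm bi}(n, k) \sim \frac{1}{2^{k-1}}\, N(n,k). \]
   Context: $N(n,k)$ is the number of connected simple graphs on the labeled vertex set $\{1,\dots,n\}$ with exactly $n-1+k$ edges (i.e. with Betti number $k$). For integers $r,s\ge 0$ and $k$, $N_{\rm bi}(r,s,k)$ is the number of connected bipartite simple graphs with labeled bipartition $V_1\sqcup V_2$, $|V_1|=r$, $|V_2|=s$, having exactly $r+s+k-1$ edges; equivalently, the number of connected spanning subgraphs of the complete bipartite graph $K_{r,s}$ with $r+s+k-1$ edges (so the Betti number is $k$). Conventions: if $rs=0$, then $N_{\rm bi}(r,s,k)=1$ if $k=0$ and $(r,s)\in\{(1,0),(0,1)\}$, and $0$ otherwise. Define \[ N_{\rm bi}(n,k) := \sum_{r+s=n}\binom{n}{r}N_{\rm bi}(r,s,k). \] Here $a_n\sim b_n$ means $a_n/b_n\to1$. *)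

theory Defs
  imports Complex_Main "Graph_Theory.Digraph_Component"
begin

text \<open>
  A finite simple undirected graph is a \<open>pair_graph\<close>, i.e. a finite symmetric loop-free
  digraph whose arcs are pairs of vertices.  Each undirected edge is therefore represented by
  two opposite arcs, and edges have to be counted as unordered pairs.
\<close>

definition undirected_edges :: "'a pair_pre_digraph \<Rightarrow> 'a set set" where
  "undirected_edges G = (\<lambda>(u, v). {u, v}) ` parcs G"

definition bipartite_with :: "'a set \<Rightarrow> 'a set \<Rightarrow> 'a pair_pre_digraph \<Rightarrow> bool" where
  "bipartite_with V1 V2 G \<longleftrightarrow> V1 \<inter> V2 = {} \<and> pverts G = V1 \<union> V2 \<and>
     (\<forall>(u, v) \<in> parcs G. u \<in> V1 \<and> v \<in> V2 \<or> u \<in> V2 \<and> v \<in> V1)"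

text \<open>
  In the two counts below, the number of edges (\<open>n - 1 + k\<close> and \<open>r + s + k - 1\<close>) is prescribed
  in a form that avoids truncated subtraction.
\<close>

definition N :: "nat \<Rightarrow> nat \<Rightarrow> nat" where
  "N n k = card {G :: nat pair_pre_digraph.
     pair_graph G \<and> pverts G = {1..n} \<and> Digraph_Component.connected (with_proj G) \<and>
     card (undirected_edges G) + 1 = n + k}"

text \<open>The two classes \<open>V\<^sub>1\<close> and \<open>V\<^sub>2\<close> are the tagged copies of \<open>{1..r}\<close> and \<open>{1..s}\<close> in a sum type.\<close>

definition N_bi :: "nat \<Rightarrow> nat \<Rightarrow> nat \<Rightarrow> nat" where
  "N_bi r s k =
     (if r * s = 0 then (if k = 0 \<and> (r, s) \<in> {(1, 0), (0, 1)} then 1 else 0)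
      else card {G :: (nat + nat) pair_pre_digraph.
        pair_graph G \<and> bipartite_with (Inl ` {1..r}) (Inr ` {1..s}) G \<and>
        Digraph_Component.connected (with_proj G) \<and>
        card (undirected_edges G) + 1 = r + s + k})"

definition N_bi_total :: "nat \<Rightarrow> nat \<Rightarrow> nat" where
  "N_bi_total n k = (\<Sum>(r, s) \<in> {(r, s). r + s = n}. (n choose r) * N_bi r s k)"

end

theory Submission
  imports Defs
begin

text \<open>
  Writing the indicator that a sign vector \<open>s\<close> is a proper 2-colouring as the product of
  \<open>(1 - s u * s v) / 2\<close> over the edges and expanding shows that a connected graph with Betti number
  \<open>k\<close> has \<open>2 powi (1 - k)\<close> times \<open>\<Sum>c. (-1) ^ card c\<close> proper 2-colourings, \<open>c\<close> ranging over its \<open>2 ^ k\<close>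
  even subgraphs.  Summed over all graphs, the terms with \<open>c = {}\<close> give \<open>N n k\<close>, and it remains to see
  that the signed number of pairs (graph, nonempty \<open>c\<close>) is of smaller order.

  Take a vertex \<open>x\<close> hanging at a bridge \<open>{x, y}\<close> and an edge \<open>{a, b}\<close> of \<open>c\<close> beyond that bridge, and replace
  these two edges by \<open>{x, a}\<close> and \<open>{x, b}\<close>.  This is reversible and lengthens \<open>c\<close> by one.  If \<open>a l\<close> is the
  number of pairs with \<open>card c = l\<close>, counting the moves from both ends gives
  \<open>(l + 1) * a (l + 1) = l * a l\<close> up to \<open>O(a (l + 1))\<close> and an error controlled by the mean number of
  nonbridges, which is \<open>O(sqrt n)\<close> by the same count.  So \<open>a\<close> varies slowly and its alternating sum
  nearly cancels for large \<open>l\<close>, whereas each fixed \<open>l\<close> is negligible because the harmonic series diverges.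
\<close>

section \<open>Even subgraphs and 2-colourings\<close>

text \<open>Why the count closes: let \<open>n = card V\<close> and let \<open>h\<close> be the
  number of nonbridges. A fixed edge of \<open>c\<close> can receive one end of each of the
  \<open>n - 1 + k - h\<close> bridges, while a vertex of degree two on \<open>c\<close> can be cut
  out and hung at almost any of the \<open>n\<close> vertices. The factor \<open>n\<close> cancels
  and \<open>h / n\<close> measures the relative error. With all nonbridges in place of
  \<open>c\<close>, the same count compares \<open>h * (n - 1 + k - h)\<close> with
  \<open>n * h - O(n)\<close>; the terms \<open>n * h\<close> cancel, so the mean of
  \<open>h ^ 2\<close> is \<open>O(n)\<close>. The delicate side is the lower bound for extractions
  when \<open>k\<close> is large: vertices may have degree above two among the nonbridges, the new
  edge may already be present, and the part moved along with the vertex may be big. These losses are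
  controlled by the Betti number and by the number \<open>2 ^ k\<close> of even subgraphs, and give
  the constant \<open>3 * k + 4 * 2 ^ k\<close>. Connectivity and bridges are expressed by vertex
  sets that no edge leaves, not by paths: such sets are closed under union and difference, which is
  what the switching uses.\<close>

definition all_edges :: "'a set \<Rightarrow> 'a set set" where
  "all_edges V = {e. e \<subseteq> V \<and> card e = 2}"

text \<open>\<open>S\<close> is not confined to the vertex set, so that complements of uncut sets
  are uncut.\<close>

definition uncut :: "'a set \<Rightarrow> 'a set set \<Rightarrow> bool" where
  "uncut S E \<longleftrightarrow> (\<forall>e\<in>E. e \<subseteq> S \<or> e \<inter> S = {})"

definition conn_graphs :: "'a set \<Rightarrow> nat \<Rightarrow> 'a set set set" where
  "conn_graphs V k = {E. E \<subseteq> all_edges V \<and> (\<forall>S\<subseteq>V. uncut S E \<longrightarrow> S = {} \<or> S = V) \<and>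
     card E + 1 = card V + k}"

text \<open>Removing such an edge separates nothing. In a connected graph these are the edges that
  lie on cycles, here on even subgraphs (\<open>even_sub_nonbridges\<close>,
  \<open>nonbridge_in_even_sub\<close>).\<close>

definition nonbridges :: "'a set set \<Rightarrow> 'a set set" where
  "nonbridges E = {e \<in> E. \<forall>S. uncut S (E - {e}) \<longrightarrow> e \<subseteq> S \<or> e \<inter> S = {}}"

definition deg :: "'a set set \<Rightarrow> 'a \<Rightarrow> nat" where
  "deg c v = card {e \<in> c. v \<in> e}"

text \<open>This is the cycle space over the two-element field.\<close>

definition even_subs :: "'a set set \<Rightarrow> 'a set set set" where
  "even_subs E = {c. c \<subseteq> E \<and> (\<forall>v. even (deg c v))}"

definition star :: "'a \<Rightarrow> 'a set \<Rightarrow> 'a set set" where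
  "star x f = (\<lambda>a. {x, a}) ` f"

lemma finite_all_edges: "finite V \<Longrightarrow> finite (all_edges V)"
  unfolding all_edges_def by (rule finite_subset[of _ "Pow V"]) auto

lemma all_edgesE:
  assumes "e \<in> all_edges V"
  obtains a b where "e = {a, b}" "a \<noteq> b" "a \<in> V" "b \<in> V"
  using assms unfolding all_edges_def by (auto simp: card_2_iff)

lemma finite_edges: "finite V \<Longrightarrow> E \<subseteq> all_edges V \<Longrightarrow> finite E"
  using finite_all_edges finite_subset by blast

lemma finite_even_subs: "finite E \<Longrightarrow> finite (even_subs E)"
  unfolding even_subs_def by (rule finite_subset[of _ "Pow E"]) auto

text \<open>Orthogonality of characters: regrouping by vertices turns the sum over \<open>S\<close>
  into the product of \<open>1 + (-1) ^ deg c v\<close>, which vanishes as soon as one degree is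
  odd.\<close>

lemma sum_sign_product:
  fixes V :: "'a set"
  assumes V: "finite V" and c: "c \<subseteq> all_edges V"
  shows "(\<Sum>S\<in>Pow V. \<Prod>e\<in>c. (-1::real) ^ card (S \<inter> e)) =
    (if c \<in> even_subs c then 2 ^ card V else 0)"
proof -
  have fc: "finite c" using finite_edges[OF V c] .
  have *: "(\<Prod>e\<in>c. (-1::real) ^ card (S \<inter> e)) = (\<Prod>v\<in>S. (-1) ^ deg c v)" if "S \<subseteq> V" for S
  proof -
    have fS: "finite S" using that V finite_subset by blast
    have "(\<Prod>e\<in>c. (-1::real) ^ card (S \<inter> e)) = (\<Prod>e\<in>c. \<Prod>v\<in>S. if v \<in> e then -1 else 1)"
      using fS by (intro prod.cong refl) (simp add: prod.If_cases)
    also have "\<dots> = (\<Prod>v\<in>S. \<Prod>e\<in>c. if v \<in> e then -1 else 1)" by (rule prod.swap)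
    also have "\<dots> = (\<Prod>v\<in>S. (-1) ^ deg c v)"
      using fc by (intro prod.cong refl) (simp add: prod.If_cases deg_def Collect_conj_eq)
    finally show ?thesis .
  qed
  have "(\<Sum>S\<in>Pow V. \<Prod>e\<in>c. (-1::real) ^ card (S \<inter> e)) = (\<Sum>S\<in>Pow V. \<Prod>v\<in>S. (-1) ^ deg c v)"
    using * by (intro sum.cong refl) auto
  also have "\<dots> = (\<Prod>v\<in>V. (-1) ^ deg c v + 1)"
    by (subst prod_add[OF V]) simp
  also have "\<dots> = (if c \<in> even_subs c then 2 ^ card V else 0)"
  proof (cases "c \<in> even_subs c")
    case True
    then have "\<And>v. even (deg c v)" by (auto simp: even_subs_def)
    then show ?thesis using True by simp
  next
    case False
    then obtain v where v: "odd (deg c v)" by (auto simp: even_subs_def)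
    then have "deg c v \<noteq> 0" by (metis even_zero)
    then have "v \<in> V" using c fc unfolding deg_def all_edges_def by (auto simp: card_eq_0_iff)
    then show ?thesis using False v V by (auto intro!: prod_zero bexI[of _ v])
  qed
  finally show ?thesis .
qed

text \<open>Expand the product over the edges and evaluate the resulting character sums over \<open>S\<close>.\<close>

lemma sum_even_subs:
  fixes V :: "'a set" and t :: real
  assumes V: "finite V" and E: "E \<subseteq> all_edges V"
  shows "2 ^ card V * (\<Sum>c\<in>even_subs E. t ^ card c) =
    (\<Sum>S\<in>Pow V. \<Prod>e\<in>E. 1 + t * (-1) ^ card (S \<inter> e))"
proof -
  have fE: "finite E" using finite_edges[OF V E] .
  have "(\<Sum>S\<in>Pow V. \<Prod>e\<in>E. 1 + t * (-1) ^ card (S \<inter> e)) =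
     (\<Sum>S\<in>Pow V. \<Sum>c\<in>Pow E. t ^ card c * (\<Prod>e\<in>c. (-1) ^ card (S \<inter> e)))"
    by (subst add.commute, subst prod_add[OF fE]) (simp add: prod.distrib)
  also have "\<dots> = (\<Sum>c\<in>Pow E. t ^ card c * (\<Sum>S\<in>Pow V. \<Prod>e\<in>c. (-1) ^ card (S \<inter> e)))"
    by (subst sum.swap) (simp add: sum_distrib_left)
  also have "\<dots> = (\<Sum>c\<in>Pow E. if c \<in> even_subs c then 2 ^ card V * t ^ card c else 0)"
    using E by (intro sum.cong refl, subst sum_sign_product[OF V]) auto
  also have "\<dots> = (\<Sum>c\<in>even_subs E. 2 ^ card V * t ^ card c)"
    using fE by (subst sum.inter_filter[symmetric]) (auto intro!: sum.cong simp: even_subs_def)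
  finally show ?thesis by (simp add: sum_distrib_left)
qed

lemma card_inter_edge:
  assumes "e \<in> all_edges V"
  shows "(-1::real) ^ card (S \<inter> e) = (if e \<subseteq> S \<or> e \<inter> S = {} then 1 else -1)"
  using assms by (elim all_edgesE) (auto simp: Int_insert_right)

lemma card_inter_edge_eq_1:
  assumes "e \<in> all_edges V"
  shows "card (S \<inter> e) = 1 \<longleftrightarrow> \<not> (e \<subseteq> S \<or> e \<inter> S = {})"
  using assms by (elim all_edgesE) (auto simp: Int_insert_right)

text \<open>Case \<open>t = 1\<close> of \<open>sum_even_subs\<close>: the product vanishes unless
  \<open>S\<close> is uncut, so only \<open>{}\<close> and \<open>V\<close> contribute. The number
  of edges is left free because the lemma is also applied after deletion of a nonbridge.\<close>

lemma card_even_subs_connected: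
  fixes V :: "'a set"
  assumes V: "finite V" "V \<noteq> {}" and EV: "E \<subseteq> all_edges V"
    and conn: "\<And>S. S \<subseteq> V \<Longrightarrow> uncut S E \<Longrightarrow> S = {} \<or> S = V"
  shows "2 ^ card V * card (even_subs E) = 2 ^ (card E + 1)"
proof -
  have fE: "finite E" using finite_edges[OF V(1) EV] .
  have "(\<Prod>e\<in>E. 1 + 1 * (-1::real) ^ card (S \<inter> e)) = (if S \<in> {{}, V} then 2 ^ card E else 0)"
    if "S \<in> Pow V" for S
  proof (cases "uncut S E")
    case True
    then have "S \<in> {{}, V}" using that conn by auto
    moreover have "(\<Prod>e\<in>E. 1 + 1 * (-1::real) ^ card (S \<inter> e)) = (\<Prod>e\<in>E. 2)"
      using True EV by (intro prod.cong refl) (subst card_inter_edge[of _ V], auto simp: uncut_def)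
    ultimately show ?thesis by simp
  next
    case False
    then obtain e where e: "e \<in> E" "\<not> (e \<subseteq> S \<or> e \<inter> S = {})" by (auto simp: uncut_def)
    then have "1 + 1 * (-1::real) ^ card (S \<inter> e) = 0"
      using EV by (subst card_inter_edge[of _ V]) auto
    then have "(\<Prod>e\<in>E. 1 + 1 * (-1::real) ^ card (S \<inter> e)) = 0"
      using e(1) fE by (intro prod_zero) auto
    moreover have "S \<notin> {{}, V}" using e EV by (auto simp: all_edges_def)
    ultimately show ?thesis by simp
  qed
  then have "2 ^ card V * (\<Sum>c\<in>even_subs E. (1::real) ^ card c) =
      (\<Sum>S\<in>Pow V. if S \<in> {{}, V} then 2 ^ card E else 0)"
    by (subst sum_even_subs[OF V(1) EV]) (intro sum.cong, auto)
  also have "\<dots> = (\<Sum>S\<in>{{}, V}. 2 ^ card E)"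
    using V(1) by (intro sum.mono_neutral_cong_right) auto
  also have "\<dots> = 2 ^ (card E + 1)" using V by simp
  finally have "real (2 ^ card V * card (even_subs E)) = real (2 ^ (card E + 1))" by simp
  then show ?thesis by (simp only: of_nat_eq_iff)
qed

lemma card_even_subs:
  assumes "finite V" "V \<noteq> {}" and E: "E \<in> conn_graphs V k"
  shows "card (even_subs E) = 2 ^ k"
proof -
  have "2 ^ card V * card (even_subs E) = 2 ^ (card E + 1)"
    using assms by (intro card_even_subs_connected) (auto simp: conn_graphs_def)
  also have "\<dots> = 2 ^ card V * 2 ^ k"
    using E by (simp only: conn_graphs_def mem_Collect_eq power_add)
  finally show ?thesis by simp
qed

text \<open>Case \<open>t = -1\<close> of \<open>sum_even_subs\<close>: the product vanishes unless
  every edge has exactly one end in \<open>S\<close>.\<close>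

lemma card_bipartitions:
  fixes V :: "'a set"
  assumes V: "finite V" and E: "E \<in> conn_graphs V k"
  shows "2 ^ k * real (card {S \<in> Pow V. \<forall>e\<in>E. card (S \<inter> e) = 1}) =
    2 * (\<Sum>c\<in>even_subs E. (-1) ^ card c)"
proof -
  have EV: "E \<subseteq> all_edges V" and c: "card E + 1 = card V + k"
    using E by (auto simp: conn_graphs_def)
  have fE: "finite E" using finite_edges[OF V EV] .
  have "(\<Prod>e\<in>E. 1 + (-1) * (-1::real) ^ card (S \<inter> e)) =
      (if \<forall>e\<in>E. card (S \<inter> e) = 1 then 2 ^ card E else 0)" for S
  proof (cases "\<forall>e\<in>E. card (S \<inter> e) = 1")
    case True
    then show ?thesis by simp
  next
    case False
    then obtain e where e: "e \<in> E" "card (S \<inter> e) \<noteq> 1" by auto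
    then have "1 + (-1) * (-1::real) ^ card (S \<inter> e) = 0"
      using EV card_inter_edge_eq_1[of e V S] by (subst card_inter_edge[of _ V]) auto
    then have "(\<Prod>e\<in>E. 1 + (-1) * (-1::real) ^ card (S \<inter> e)) = 0"
      using e(1) fE by (intro prod_zero) auto
    then show ?thesis using False by simp
  qed
  then have "2 ^ card V * (\<Sum>c\<in>even_subs E. (-1::real) ^ card c) =
      (\<Sum>S\<in>Pow V. if \<forall>e\<in>E. card (S \<inter> e) = 1 then 2 ^ card E else 0)"
    by (subst sum_even_subs[OF V EV]) (intro sum.cong, auto)
  also have "\<dots> = 2 ^ card E * real (card {S \<in> Pow V. \<forall>e\<in>E. card (S \<inter> e) = 1})"
    using V by (subst sum.inter_filter[symmetric]) (auto simp: mult.commute)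
  \<comment> \<open>The extra factor 2 completes the exponent to \<open>card E + 1\<close>, which
    equals \<open>card V + k\<close>.\<close>
  finally have "2 ^ card V * (2 * (\<Sum>c\<in>even_subs E. (-1::real) ^ card c)) =
     2 ^ (card E + 1) * real (card {S \<in> Pow V. \<forall>e\<in>E. card (S \<inter> e) = 1})" by simp
  also have "\<dots> = 2 ^ card V * (2 ^ k * real (card {S \<in> Pow V. \<forall>e\<in>E. card (S \<inter> e) = 1}))"
    by (simp only: c power_add mult.assoc)
  finally show ?thesis by simp
qed

section \<open>Switching\<close>

lemma uncut_Compl: "uncut (- S) E \<longleftrightarrow> uncut S E"
  unfolding uncut_def by auto

text \<open>Union and difference are what the switching needs: adding or removing the side
  \<open>S\<close> of \<open>x\<close> flips \<open>x\<close> without touching the vertices outside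
  \<open>S\<close>.\<close>

lemma uncut_Un: "uncut S E \<Longrightarrow> uncut T E \<Longrightarrow> uncut (S \<union> T) E"
  unfolding uncut_def by blast

lemma uncut_Diff: "uncut S E \<Longrightarrow> uncut T E \<Longrightarrow> uncut (S - T) E"
  unfolding uncut_def by blast

lemma uncut_insert: "uncut S (insert e E) \<longleftrightarrow> (e \<subseteq> S \<or> e \<inter> S = {}) \<and> uncut S E"
  unfolding uncut_def by blast

lemma uncut_mono: "uncut S E \<Longrightarrow> D \<subseteq> E \<Longrightarrow> uncut S D"
  unfolding uncut_def by blast

lemma uncutD: "uncut S E \<Longrightarrow> {a, b} \<in> E \<Longrightarrow> a \<in> S \<longleftrightarrow> b \<in> S"
  unfolding uncut_def by auto

lemma uncut_insert_doubleton: "uncut S (insert {a, b} E) \<longleftrightarrow> (a \<in> S \<longleftrightarrow> b \<in> S) \<and> uncut S E"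
  unfolding uncut_def by auto

lemma nonbridges_doubleton:
  "{a, b} \<in> nonbridges E \<longleftrightarrow>
    {a, b} \<in> E \<and> (\<forall>S. uncut S (E - {{a, b}}) \<longrightarrow> (a \<in> S \<longleftrightarrow> b \<in> S))"
proof -
  have "{a, b} \<subseteq> S \<or> {a, b} \<inter> S = {} \<longleftrightarrow> (a \<in> S \<longleftrightarrow> b \<in> S)" for S by auto
  then show ?thesis unfolding nonbridges_def by simp
qed

text \<open>Edges lie inside \<open>V\<close>, so \<open>S\<close> may be replaced by
  \<open>S \<inter> V\<close>. This frees connectivity from the restriction to subsets of
  \<open>V\<close>.\<close>

lemma conn_graphsD:
  assumes "E \<in> conn_graphs V k" "uncut S E"
  shows "V \<subseteq> S \<or> V \<inter> S = {}"
proof -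
  have EV: "E \<subseteq> all_edges V" and conn: "\<And>S. S \<subseteq> V \<Longrightarrow> uncut S E \<Longrightarrow> S = {} \<or> S = V"
    using assms(1) by (auto simp: conn_graphs_def)
  have "e \<subseteq> S \<inter> V \<or> e \<inter> (S \<inter> V) = {}" if "e \<in> E" for e
  proof -
    have "e \<subseteq> V" using that EV by (auto simp: all_edges_def)
    moreover have "e \<subseteq> S \<or> e \<inter> S = {}" using that assms(2) by (auto simp: uncut_def)
    ultimately show ?thesis by blast
  qed
  then have "uncut (S \<inter> V) E" by (auto simp: uncut_def)
  then have "S \<inter> V = {} \<or> S \<inter> V = V" by (intro conn) auto
  then show ?thesis by blast
qed

lemma conn_graphsI:
  assumes "E \<subseteq> all_edges V" "card E + 1 = card V + k"
    "\<And>S. uncut S E \<Longrightarrow> V \<subseteq> S \<or> V \<inter> S = {}"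
  shows "E \<in> conn_graphs V k"
  using assms unfolding conn_graphs_def by blast

lemma sum_deg:
  assumes "finite c" "finite S"
  shows "(\<Sum>v\<in>S. deg c v) = (\<Sum>e\<in>c. card (S \<inter> e))"
proof -
  have "(\<Sum>v\<in>S. deg c v) = (\<Sum>v\<in>S. \<Sum>e\<in>c. if v \<in> e then 1 else 0)"
    using assms by (intro sum.cong refl) (simp add: deg_def sum.If_cases Collect_conj_eq)
  also have "\<dots> = (\<Sum>e\<in>c. \<Sum>v\<in>S. if v \<in> e then 1 else 0)" by (rule sum.swap)
  also have "\<dots> = (\<Sum>e\<in>c. card (S \<inter> e))"
    using assms by (intro sum.cong refl) (simp add: sum.If_cases)
  finally show ?thesis .
qed

lemma nonbridges_subset: "nonbridges E \<subseteq> E"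
  unfolding nonbridges_def by auto

text \<open>An even subgraph crosses every cut an even number of times, whereas a bridge in
  \<open>c\<close> would be the only edge of \<open>c\<close> across its cut.\<close>

lemma even_sub_nonbridges:
  assumes V: "finite V" and E: "E \<subseteq> all_edges V" and c: "c \<in> even_subs E"
  shows "c \<subseteq> nonbridges E"
proof
  fix e assume e: "e \<in> c"
  have cE: "c \<subseteq> E" using c by (auto simp: even_subs_def)
  have fc: "finite c" using finite_edges[OF V] cE E by auto
  have "e \<subseteq> S \<or> e \<inter> S = {}" if S: "uncut S (E - {e})" for S
  proof (rule ccontr)
    assume neg: "\<not> ?thesis"
    let ?S = "S \<inter> V"
    have eV: "e \<in> all_edges V" using e cE E by auto
    have "e \<inter> ?S \<noteq> {}" "\<not> e \<subseteq> ?S" using neg eV by (auto simp: all_edges_def)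
    then have 1: "card (?S \<inter> e) = 1" by (subst card_inter_edge_eq_1[OF eV]) auto
    have "even (card (?S \<inter> e'))" if "e' \<in> c - {e}" for e'
    proof -
      have e'V: "e' \<in> all_edges V" using that cE E by auto
      have "e' \<subseteq> S \<or> e' \<inter> S = {}" using S that cE by (auto simp: uncut_def)
      then show ?thesis
      proof
        assume "e' \<subseteq> S"
        then have "?S \<inter> e' = e'" using e'V by (auto simp: all_edges_def)
        then show ?thesis using e'V by (auto simp: all_edges_def)
      next
        assume "e' \<inter> S = {}"
        then have "?S \<inter> e' = {}" by auto
        then show ?thesis by simp
      qed
    qed
    then have "even (\<Sum>e'\<in>c - {e}. card (?S \<inter> e'))" by (intro dvd_sum) auto
    then have "odd (\<Sum>e'\<in>c. card (?S \<inter> e'))"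
      using 1 e fc by (subst sum.remove[of _ e]) auto
    moreover have "(\<Sum>v\<in>?S. deg c v) = (\<Sum>e'\<in>c. card (?S \<inter> e'))"
      using fc V by (intro sum_deg) auto
    moreover have "even (\<Sum>v\<in>?S. deg c v)"
      using c by (intro dvd_sum) (auto simp: even_subs_def)
    ultimately show False by simp
  qed
  then show "e \<in> nonbridges E" using e cE by (auto simp: nonbridges_def)
qed

lemma deg_insert:
  assumes "finite c" "e \<notin> c"
  shows "deg (insert e c) v = deg c v + (if v \<in> e then 1 else 0)"
proof -
  have "{e' \<in> insert e c. v \<in> e'} = (if v \<in> e then insert e {e' \<in> c. v \<in> e'} else {e' \<in> c. v \<in> e'})"
    by auto
  then show ?thesis using assms by (auto simp: deg_def)
qed

text \<open>
  The switching: a vertex \<open>x\<close> attached to the rest by a bridge \<open>{x, y}\<close> is moved, with everything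
  behind the bridge, into a nonbridge \<open>f = {a, b}\<close> on the side of \<open>y\<close>, which becomes the path \<open>a, x, b\<close>.
  Extractions are the reverse moves.  The same set \<open>S\<close>, the side of \<open>x\<close>, witnesses both directions.
\<close>

definition insertions :: "'a set set \<Rightarrow> ('a \<times> 'a \<times> 'a set) set" where
  "insertions E = {(x, y, f). {x, y} \<in> E \<and> f \<in> nonbridges E \<and>
     (\<exists>S. uncut S (E - {{x, y}}) \<and> x \<in> S \<and> y \<notin> S \<and> f \<inter> S = {})}"

definition extractions :: "'a set \<Rightarrow> 'a set set \<Rightarrow> ('a \<times> 'a \<times> 'a set) set" where
  "extractions V E = {(x, y, f). x \<in> V \<and> y \<in> V \<and> f \<in> all_edges V \<and> f \<notin> E \<and>
     star x f \<subseteq> nonbridges E \<and>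
     (\<exists>S. uncut S (E - star x f) \<and> x \<in> S \<and> y \<notin> S \<and> f \<inter> S = {})}"

text \<open>Deletion precedes addition. This matters when \<open>y \<in> f\<close>: then
  \<open>{x, y}\<close> is removed and put back as an edge of the star.\<close>

definition insert_vertex :: "'a \<times> 'a \<times> 'a set \<Rightarrow> 'a set set \<Rightarrow> 'a set set" where
  "insert_vertex = (\<lambda>(x, y, f) E. E - {{x, y}, f} \<union> star x f)"

definition extract_vertex :: "'a \<times> 'a \<times> 'a set \<Rightarrow> 'a set set \<Rightarrow> 'a set set" where
  "extract_vertex = (\<lambda>(x, y, f) E. E - star x f \<union> {{x, y}, f})"

lemma star_doubleton: "star x {a, b} = {{x, a}, {x, b}}"
  by (auto simp: star_def)

text \<open>Replacing an edge by a path of length two raises the degree of \<open>x\<close> by two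
  and keeps those of \<open>a\<close> and \<open>b\<close>.\<close>

lemma even_subs_switch:
  assumes "finite D" "a \<noteq> b" "x \<noteq> a" "x \<noteq> b" "{a, b} \<notin> D" "{x, a} \<notin> D" "{x, b} \<notin> D"
  shows "(\<forall>v. even (deg (insert {a, b} D) v)) \<longleftrightarrow> (\<forall>v. even (deg (D \<union> {{x, a}, {x, b}}) v))"
proof -
  have ne: "{x, a} \<noteq> {x, b}" using assms by (auto simp: doubleton_eq_iff)
  have "even (deg (insert {a, b} D) v) \<longleftrightarrow> even (deg (D \<union> {{x, a}, {x, b}}) v)" for v
    using assms ne by (auto simp: deg_insert)
  then show ?thesis by simp
qed

text \<open>Both graphs share the part \<open>R\<close>: one is \<open>R\<close> with
  \<open>{x, y}\<close> and \<open>{a, b}\<close>, the other \<open>R\<close> with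
  \<open>{x, a}\<close> and \<open>{x, b}\<close>. Connectivity and nonbridges of either are
  therefore statements about sets \<open>Z\<close> uncut in \<open>R\<close>, and \<open>S\<close>
  is such a set.\<close>

lemma insertion:
  assumes V: "finite V" and E: "E \<in> conn_graphs V k" and m: "m \<in> insertions E"
  shows "insert_vertex m E \<in> conn_graphs V k" (is ?G)
    and "m \<in> extractions V (insert_vertex m E)" (is ?M)
    and "extract_vertex m (insert_vertex m E) = E" (is ?I)
proof -
  obtain x y f where m_eq: "m = (x, y, f)" by (cases m)
  obtain S where xy: "{x, y} \<in> E" and f: "f \<in> nonbridges E"
    and S: "uncut S (E - {{x, y}})" "x \<in> S" "y \<notin> S" "f \<inter> S = {}"
    using m by (auto simp: insertions_def m_eq)
  have EV: "E \<subseteq> all_edges V" and cE: "card E + 1 = card V + k"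
    using E by (auto simp: conn_graphs_def)
  have fE: "finite E" using finite_edges[OF V EV] .
  have fE': "f \<in> E" using f nonbridges_subset by auto
  obtain a b where ab: "f = {a, b}" "a \<noteq> b" "a \<in> V" "b \<in> V"
    using fE' EV by (metis all_edgesE subsetD)
  have xV: "x \<in> V" "y \<in> V" using xy EV by (auto simp: all_edges_def)
  define R where "R = E - {{x, y}, f}"
  have nS: "a \<notin> S" "b \<notin> S" using S(4) ab by auto
  have ne: "x \<noteq> y" "x \<noteq> a" "x \<noteq> b" using S nS by auto
  have xyf: "{x, y} \<noteq> {a, b}" using S nS by (auto simp: doubleton_eq_iff)
  have E_eq: "E = insert {x, y} (insert {a, b} R)" using xy fE' ab by (auto simp: R_def)
  have SR: "uncut S R" using S(1) by (rule uncut_mono) (auto simp: R_def)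
  \<comment> \<open>No edge of \<open>R\<close> leaves \<open>S\<close>, so the star edges are not
    in \<open>R\<close>; the graph stays simple and the number of edges is kept.\<close>
  have nR: "{x, a} \<notin> R" "{x, b} \<notin> R" "{x, y} \<notin> R" "{a, b} \<notin> R"
  proof -
    show "{x, a} \<notin> R" using SR S(2) nS by (auto simp: uncut_def)
    show "{x, b} \<notin> R" using SR S(2) nS by (auto simp: uncut_def)
    show "{x, y} \<notin> R" by (simp add: R_def)
    show "{a, b} \<notin> R" using ab(1) by (simp add: R_def)
  qed
  have R_eq: "E - {{a, b}} = insert {x, y} R" using E_eq nR xyf by auto
  define E' where "E' = insert {x, a} (insert {x, b} R)"
  have E'_eq: "insert_vertex m E = E'"
    by (auto simp: insert_vertex_def m_eq ab star_doubleton R_def E'_def)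
  have ne2: "{x, a} \<noteq> {x, b}" using ab ne by (auto simp: doubleton_eq_iff)
  have conn: "V \<subseteq> Z \<or> V \<inter> Z = {}" if "uncut Z R" "x \<in> Z \<longleftrightarrow> y \<in> Z" "a \<in> Z \<longleftrightarrow> b \<in> Z" for Z
    using that by (intro conn_graphsD[OF E]) (simp add: E_eq uncut_insert_doubleton)
  have nb: "a \<in> Z \<longleftrightarrow> b \<in> Z" if "uncut Z R" "x \<in> Z \<longleftrightarrow> y \<in> Z" for Z
  proof -
    have "uncut Z (E - {f})" using that by (simp add: ab R_eq uncut_insert_doubleton)
    then have "f \<subseteq> Z \<or> f \<inter> Z = {}" using f by (auto simp: nonbridges_def)
    then show ?thesis using ab by auto
  qed
  \<comment> \<open>If \<open>Z\<close> separates \<open>x\<close> from \<open>y\<close>, adding or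
    removing \<open>S\<close> brings \<open>x\<close> to the side of \<open>y\<close> and leaves
    \<open>y\<close>, \<open>a\<close>, \<open>b\<close> where they are. The result is uncut in
    \<open>E\<close> but separates \<open>x\<close> from \<open>a\<close>, a contradiction.\<close>
  have conn': "V \<subseteq> Z \<or> V \<inter> Z = {}" if Z: "uncut Z R" "x \<in> Z \<longleftrightarrow> a \<in> Z" "x \<in> Z \<longleftrightarrow> b \<in> Z" for Z
  proof (cases "x \<in> Z \<longleftrightarrow> y \<in> Z")
    case True
    then show ?thesis using conn[of Z] Z by blast
  next
    case False
    then show ?thesis
      using conn[of "Z - S"] conn[of "Z \<union> S"] uncut_Diff[OF Z(1) SR] uncut_Un[OF Z(1) SR]
        Z S nS xV ab by blast
  qed
  \<comment> \<open>Again \<open>S\<close> is used to make \<open>x\<close> agree with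
    \<open>y\<close>; this does not affect \<open>a\<close> and \<open>b\<close>, which agree
    because \<open>f\<close> is a nonbridge of \<open>E\<close>.\<close>
  have nb': "x \<in> Z \<longleftrightarrow> a \<in> Z" if Z: "uncut Z R" "x \<in> Z \<longleftrightarrow> b \<in> Z" for Z
    using nb[of "Z - S"] nb[of "Z \<union> S"] nb[of Z] uncut_Diff[OF Z(1) SR] uncut_Un[OF Z(1) SR]
        Z S nS by blast
  have nb'': "x \<in> Z \<longleftrightarrow> b \<in> Z" if Z: "uncut Z R" "x \<in> Z \<longleftrightarrow> a \<in> Z" for Z
    using nb[of "Z - S"] nb[of "Z \<union> S"] nb[of Z] uncut_Diff[OF Z(1) SR] uncut_Un[OF Z(1) SR]
        Z S nS by blast
  have fR: "finite R" using fE by (auto simp: R_def)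
  have "card E' = card E" using fR nR ne2 xyf by (simp add: E'_def E_eq)
  moreover have "E' \<subseteq> all_edges V"
    using EV ab xV ne by (auto simp: E'_def R_def all_edges_def)
  moreover have "V \<subseteq> Z \<or> V \<inter> Z = {}" if "uncut Z E'" for Z
    using that unfolding E'_def uncut_insert_doubleton by (intro conn') blast+
  ultimately show ?G unfolding E'_eq using cE by (intro conn_graphsI) simp_all
  have "star x f \<subseteq> nonbridges E'"
  proof -
    have E'_minus: "E' - {{x, a}} = insert {x, b} R" "E' - {{x, b}} = insert {x, a} R"
      using nR ne2 by (auto simp: E'_def)
    then have "x \<in> Z \<longleftrightarrow> a \<in> Z" if "uncut Z (E' - {{x, a}})" for Z
      using that by (intro nb') (simp_all add: uncut_insert_doubleton)
    moreover have "x \<in> Z \<longleftrightarrow> b \<in> Z" if "uncut Z (E' - {{x, b}})" for Z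
      using that E'_minus by (intro nb'') (simp_all add: uncut_insert_doubleton)
    moreover have "{x, a} \<in> E'" "{x, b} \<in> E'" by (simp_all add: E'_def)
    ultimately have "{x, a} \<in> nonbridges E'" "{x, b} \<in> nonbridges E'"
      unfolding nonbridges_doubleton by blast+
    then show ?thesis by (simp add: ab star_doubleton)
  qed
  moreover have "E' - star x f = R" using nR by (auto simp: E'_def ab star_doubleton)
  moreover have "f \<notin> E'" using nR ab ne by (auto simp: E'_def doubleton_eq_iff)
  moreover have "f \<in> all_edges V" using EV fE' by auto
  ultimately show ?M unfolding E'_eq using SR S xV by (auto simp: extractions_def m_eq)
  show ?I unfolding E'_eq using E_eq nR ab
    by (auto simp: extract_vertex_def m_eq E'_def star_doubleton)
qed

lemma extraction:
  assumes V: "finite V" and E: "E \<in> conn_graphs V k" and m: "m \<in> extractions V E"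
  shows "extract_vertex m E \<in> conn_graphs V k" (is ?G)
    and "m \<in> insertions (extract_vertex m E)" (is ?M)
    and "insert_vertex m (extract_vertex m E) = E" (is ?I)
proof -
  obtain x y f where m_eq: "m = (x, y, f)" by (cases m)
  obtain S where xV: "x \<in> V" "y \<in> V" and f: "f \<in> all_edges V" "f \<notin> E" "star x f \<subseteq> nonbridges E"
    and S: "uncut S (E - star x f)" "x \<in> S" "y \<notin> S" "f \<inter> S = {}"
    using m by (auto simp: extractions_def m_eq)
  have EV: "E \<subseteq> all_edges V" and cE: "card E + 1 = card V + k"
    using E by (auto simp: conn_graphs_def)
  have fE: "finite E" using finite_edges[OF V EV] .
  obtain a b where ab: "f = {a, b}" "a \<noteq> b" "a \<in> V" "b \<in> V"
    using f by (metis all_edgesE)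
  define R where "R = E - {{x, a}, {x, b}}"
  have nS: "a \<notin> S" "b \<notin> S" using S(4) ab by auto
  have ne: "x \<noteq> y" "x \<noteq> a" "x \<noteq> b" using S nS by auto
  have xyf: "{x, y} \<noteq> {a, b}" using S nS by (auto simp: doubleton_eq_iff)
  have nbE: "{x, a} \<in> nonbridges E" "{x, b} \<in> nonbridges E"
    using f ab by (auto simp: star_doubleton)
  then have E_eq: "E = insert {x, a} (insert {x, b} R)"
    using nonbridges_subset[of E] by (auto simp: R_def)
  have SR: "uncut S R" using S(1) by (simp add: R_def ab star_doubleton)
  have nR: "{x, a} \<notin> R" "{x, b} \<notin> R" "{x, y} \<notin> R" "{a, b} \<notin> R"
  proof -
    show "{x, a} \<notin> R" "{x, b} \<notin> R" by (simp_all add: R_def)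
    show "{x, y} \<notin> R" using SR S(2,3) by (auto simp: uncut_def)
    show "{a, b} \<notin> R" using f(2) ab(1) by (simp add: R_def)
  qed
  have ne2: "{x, a} \<noteq> {x, b}" using ab ne by (auto simp: doubleton_eq_iff)
  have R_eq: "E - {{x, a}} = insert {x, b} R" "E - {{x, b}} = insert {x, a} R"
    using E_eq nR ne2 by auto
  define E' where "E' = insert {x, y} (insert {a, b} R)"
  have E'_eq: "extract_vertex m E = E'"
    by (auto simp: extract_vertex_def m_eq ab star_doubleton R_def E'_def)
  have conn: "V \<subseteq> Z \<or> V \<inter> Z = {}" if "uncut Z R" "x \<in> Z \<longleftrightarrow> a \<in> Z" "x \<in> Z \<longleftrightarrow> b \<in> Z" for Z
    using that by (intro conn_graphsD[OF E]) (simp add: E_eq uncut_insert_doubleton)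
  have nb: "x \<in> Z \<longleftrightarrow> a \<in> Z" if "uncut Z R" "x \<in> Z \<longleftrightarrow> b \<in> Z" for Z
  proof -
    have "uncut Z (E - {{x, a}})" using that by (simp add: R_eq uncut_insert_doubleton)
    then have "{x, a} \<subseteq> Z \<or> {x, a} \<inter> Z = {}" using nbE by (auto simp: nonbridges_def)
    then show ?thesis by auto
  qed
  have nb2: "x \<in> Z \<longleftrightarrow> b \<in> Z" if "uncut Z R" "x \<in> Z \<longleftrightarrow> a \<in> Z" for Z
  proof -
    have "uncut Z (E - {{x, b}})" using that by (simp add: R_eq uncut_insert_doubleton)
    then have "{x, b} \<subseteq> Z \<or> {x, b} \<inter> Z = {}" using nbE by (auto simp: nonbridges_def)
    then show ?thesis by auto
  qed
  \<comment> \<open>If \<open>Z\<close> separates \<open>x\<close> from \<open>a\<close>, flipping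
    \<open>x\<close> with \<open>S\<close> makes \<open>x\<close>, \<open>a\<close>,
    \<open>b\<close> agree while \<open>y\<close> remains separated from \<open>a\<close>, against
    connectivity of \<open>E\<close>.\<close>
  have conn': "V \<subseteq> Z \<or> V \<inter> Z = {}" if Z: "uncut Z R" "x \<in> Z \<longleftrightarrow> y \<in> Z" "a \<in> Z \<longleftrightarrow> b \<in> Z" for Z
  proof (cases "x \<in> Z \<longleftrightarrow> a \<in> Z")
    case True
    then show ?thesis using conn[of Z] Z by blast
  next
    case False
    then show ?thesis
      using conn[of "Z - S"] conn[of "Z \<union> S"] uncut_Diff[OF Z(1) SR] uncut_Un[OF Z(1) SR]
        Z S nS xV ab by blast
  qed
  \<comment> \<open>\<open>Z - S\<close> does not contain \<open>x\<close>. If it separated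
    \<open>a\<close> from \<open>b\<close>, then \<open>x\<close> would agree with exactly one of
    them, and the star edge to the other would be a bridge of \<open>E\<close>.\<close>
  have nb': "a \<in> Z \<longleftrightarrow> b \<in> Z" if Z: "uncut Z R" "x \<in> Z \<longleftrightarrow> y \<in> Z" for Z
    using nb[of "Z - S"] nb2[of "Z - S"] uncut_Diff[OF Z(1) SR] Z S nS by blast
  have fR: "finite R" using fE by (auto simp: R_def)
  have "card E' = card E" using fR nR ne2 xyf by (simp add: E'_def E_eq)
  moreover have "E' \<subseteq> all_edges V"
    using EV ab xV ne by (auto simp: E'_def R_def all_edges_def)
  moreover have "V \<subseteq> Z \<or> V \<inter> Z = {}" if "uncut Z E'" for Z
    using that unfolding E'_def uncut_insert_doubleton by (intro conn') blast+
  ultimately show ?G unfolding E'_eq using cE by (intro conn_graphsI) simp_all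
  have "E' - {f} = insert {x, y} R" using nR xyf by (auto simp: E'_def ab)
  then have "a \<in> Z \<longleftrightarrow> b \<in> Z" if "uncut Z (E' - {{a, b}})" for Z
    using that by (intro nb') (simp_all add: ab uncut_insert_doubleton)
  moreover have "{a, b} \<in> E'" by (simp add: E'_def)
  ultimately have "f \<in> nonbridges E'" unfolding ab(1) nonbridges_doubleton by blast
  moreover have "E' - {{x, y}} = insert f R" using nR xyf by (auto simp: E'_def ab)
  then have "uncut S (E' - {{x, y}})" using SR S by (simp add: uncut_insert)
  ultimately show ?M unfolding E'_eq using S by (auto simp: insertions_def m_eq E'_def)
  show ?I unfolding E'_eq using E_eq nR ab
    by (auto simp: insert_vertex_def m_eq E'_def star_doubleton)
qed

section \<open>Counting moves from both ends\<close>

lemma finite_conn_graphs: "finite V \<Longrightarrow> finite (conn_graphs V k)"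
  unfolding conn_graphs_def
  by (rule finite_subset[of _ "Pow (all_edges V)"]) (auto simp: finite_all_edges)

lemma insertions_subset:
  assumes "E \<subseteq> all_edges V"
  shows "insertions E \<subseteq> V \<times> V \<times> nonbridges E"
  using assms by (auto simp: insertions_def all_edges_def)

lemma extractions_subset: "extractions V E \<subseteq> V \<times> V \<times> all_edges V"
  by (auto simp: extractions_def)

lemma finite_insertions:
  assumes "finite V" "E \<subseteq> all_edges V"
  shows "finite (insertions E)"
  using insertions_subset[OF assms(2)] assms finite_edges[OF assms] nonbridges_subset[of E]
  by (meson finite_SigmaI finite_subset)

lemma finite_extractions: "finite V \<Longrightarrow> finite (extractions V E)"
  using extractions_subset[of V E] finite_all_edges[of V] by (meson finite_SigmaI finite_subset)

text \<open>The triple \<open>m\<close> is kept unchanged, so the two switchings are mutually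
  inverse on pairs (graph, move). This version without \<open>c\<close> serves the second moment of
  the number of nonbridges.\<close>

lemma card_insertions_eq_extractions:
  assumes V: "finite V"
  shows "(\<Sum>E\<in>conn_graphs V k. card (insertions E)) =
    (\<Sum>E\<in>conn_graphs V k. card (extractions V E))"
proof -
  have "bij_betw (\<lambda>(E, m). (insert_vertex m E, m))
    (Sigma (conn_graphs V k) insertions) (Sigma (conn_graphs V k) (extractions V))"
    by (rule bij_betw_byWitness[where f' = "\<lambda>(E, m). (extract_vertex m E, m)"])
      (use insertion[OF V] extraction[OF V] in auto)
  then have "card (Sigma (conn_graphs V k) insertions) = card (Sigma (conn_graphs V k) (extractions V))"
    by (rule bij_betw_same_card)
  moreover have "\<forall>E\<in>conn_graphs V k. finite (insertions E)"
    using finite_insertions[OF V] by (auto simp: conn_graphs_def)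
  ultimately show ?thesis
    using finite_conn_graphs[OF V] finite_extractions[OF V] by simp
qed

text \<open>The bridge \<open>{x, y}\<close> is not in \<open>c\<close>, so \<open>c\<close> does
  not cross \<open>S\<close>: it loses only \<open>f\<close>, and both star edges are new to
  it.\<close>

lemma insertion_even_sub:
  assumes V: "finite V" and E: "E \<in> conn_graphs V k" and m: "(x, y, f) \<in> insertions E"
    and c: "c \<in> even_subs E" "f \<in> c"
  shows "c - {f} \<union> star x f \<in> even_subs (insert_vertex (x, y, f) E)" (is ?A)
    and "card (c - {f} \<union> star x f) = card c + 1" (is ?B)
    and "c - {f} \<union> star x f - star x f \<union> {f} = c" (is ?C)
proof -
  obtain S where xy: "{x, y} \<in> E" and f: "f \<in> nonbridges E"
    and S: "uncut S (E - {{x, y}})" "x \<in> S" "y \<notin> S" "f \<inter> S = {}"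
    using m by (auto simp: insertions_def)
  have EV: "E \<subseteq> all_edges V" using E by (auto simp: conn_graphs_def)
  have fE': "f \<in> all_edges V" using f nonbridges_subset EV by blast
  obtain a b where ab: "f = {a, b}" "a \<noteq> b" using fE' by (metis all_edgesE)
  have nS: "a \<notin> S" "b \<notin> S" using S(4) ab by auto
  have ne: "x \<noteq> a" "x \<noteq> b" using S nS by auto
  have ne2: "{x, a} \<noteq> {x, b}" using ab ne by (auto simp: doubleton_eq_iff)
  have cE: "c \<subseteq> E" using c by (auto simp: even_subs_def)
  have fc: "finite c" using finite_edges[OF V] EV cE by auto
  have "{x, y} \<notin> nonbridges E" using S by (auto simp: nonbridges_doubleton)
  then have "{x, y} \<notin> c" using even_sub_nonbridges[OF V EV c(1)] by auto
  then have Sc: "uncut S c" using S(1) cE by (auto simp: uncut_def)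
  have nc: "{x, a} \<notin> c" "{x, b} \<notin> c" using Sc S(2) nS by (auto simp: uncut_def)
  define D where "D = c - {f}"
  have c_eq: "c = insert {a, b} D" using c(2) by (auto simp: D_def ab)
  have D: "finite D" "{a, b} \<notin> D" "{x, a} \<notin> D" "{x, b} \<notin> D"
    using fc nc by (auto simp: D_def ab)
  have c'_eq: "c - {f} \<union> star x f = D \<union> {{x, a}, {x, b}}" by (simp add: D_def ab star_doubleton)
  have "\<forall>v. even (deg (D \<union> {{x, a}, {x, b}}) v)"
    using even_subs_switch[of D a b x] D ab ne c by (auto simp: even_subs_def c_eq)
  moreover have "D \<union> {{x, a}, {x, b}} \<subseteq> insert_vertex (x, y, f) E"
    using cE \<open>{x, y} \<notin> c\<close> by (auto simp: insert_vertex_def D_def ab star_doubleton)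
  ultimately show ?A by (simp add: c'_eq even_subs_def)
  show ?B unfolding c'_eq using D ne2 by (simp add: c_eq)
  show ?C unfolding c'_eq using D by (simp add: c_eq star_doubleton ab)
qed

lemma extraction_even_sub:
  assumes V: "finite V" and E: "E \<in> conn_graphs V k" and m: "(x, y, f) \<in> extractions V E"
    and c: "c \<in> even_subs E" "star x f \<subseteq> c"
  shows "c - star x f \<union> {f} \<in> even_subs (extract_vertex (x, y, f) E)" (is ?A)
    and "card c = card (c - star x f \<union> {f}) + 1" (is ?B)
    and "c - star x f \<union> {f} - {f} \<union> star x f = c" (is ?C)
proof -
  obtain S where xV: "x \<in> V" "y \<in> V" and f: "f \<in> all_edges V" "f \<notin> E"
    and S: "uncut S (E - star x f)" "x \<in> S" "y \<notin> S" "f \<inter> S = {}"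
    using m by (auto simp: extractions_def)
  have EV: "E \<subseteq> all_edges V" using E by (auto simp: conn_graphs_def)
  obtain a b where ab: "f = {a, b}" "a \<noteq> b" using f by (metis all_edgesE)
  have ne: "x \<noteq> a" "x \<noteq> b" using S ab by auto
  have ne2: "{x, a} \<noteq> {x, b}" using ab ne by (auto simp: doubleton_eq_iff)
  have cE: "c \<subseteq> E" using c by (auto simp: even_subs_def)
  have fc: "finite c" using finite_edges[OF V] EV cE by auto
  define D where "D = c - star x f"
  have c_eq: "c = D \<union> {{x, a}, {x, b}}" using c(2) by (auto simp: D_def ab star_doubleton)
  have D: "finite D" "{a, b} \<notin> D" "{x, a} \<notin> D" "{x, b} \<notin> D"
    using fc f(2) cE by (auto simp: D_def ab star_doubleton)
  have c'_eq: "c - star x f \<union> {f} = insert {a, b} D" by (simp add: D_def ab)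
  have "\<forall>v. even (deg (insert {a, b} D) v)"
    using even_subs_switch[of D a b x] D ab ne c by (auto simp: even_subs_def c_eq)
  moreover have "insert {a, b} D \<subseteq> extract_vertex (x, y, f) E"
    using cE by (auto simp: extract_vertex_def D_def ab star_doubleton)
  ultimately show ?A unfolding c'_eq by (simp add: even_subs_def)
  show ?B unfolding c'_eq using D ne2 by (simp add: c_eq)
  show ?C unfolding c'_eq using D by (simp add: c_eq star_doubleton ab)
qed

definition marked :: "'a set \<Rightarrow> nat \<Rightarrow> nat \<Rightarrow> ('a set set \<times> 'a set set) set" where
  "marked V k l = {(E, c). E \<in> conn_graphs V k \<and> c \<in> even_subs E \<and> card c = l}"

lemma finite_marked:
  assumes V: "finite V"
  shows "finite (marked V k l)"
proof (rule finite_subset)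
  show "marked V k l \<subseteq> Sigma (conn_graphs V k) even_subs" by (auto simp: marked_def)
  show "finite (Sigma (conn_graphs V k) even_subs)"
    using finite_edges[OF V] finite_conn_graphs[OF V]
    by (intro finite_SigmaI finite_even_subs) (auto simp: conn_graphs_def)
qed

text \<open>The same bijection with \<open>c\<close> carried along; the edge \<open>f\<close> of
  \<open>c\<close> becomes a path, so the length goes up by one.\<close>

lemma card_marked_moves:
  assumes V: "finite V"
  shows "(\<Sum>(E, c)\<in>marked V k l. card {(x, y, f) \<in> insertions E. f \<in> c}) =
    (\<Sum>(E, c)\<in>marked V k (Suc l). card {(x, y, f) \<in> extractions V E. star x f \<subseteq> c})"
proof -
  define P where "P = Sigma (marked V k l) (\<lambda>(E, c). {(x, y, f) \<in> insertions E. f \<in> c})"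
  define Q where "Q = Sigma (marked V k (Suc l)) (\<lambda>(E, c). {(x, y, f) \<in> extractions V E. star x f \<subseteq> c})"
  define ins :: "('a set set \<times> 'a set set) \<times> ('a \<times> 'a \<times> 'a set) \<Rightarrow> _" where
    "ins = (\<lambda>((E, c), (x, y, f)). ((insert_vertex (x, y, f) E, c - {f} \<union> star x f), (x, y, f)))"
  define ext :: "('a set set \<times> 'a set set) \<times> ('a \<times> 'a \<times> 'a set) \<Rightarrow> _" where
    "ext = (\<lambda>((E, c), (x, y, f)). ((extract_vertex (x, y, f) E, c - star x f \<union> {f}), (x, y, f)))"
  have ins: "ins p \<in> Q \<and> ext (ins p) = p" if "p \<in> P" for p
  proof -
    obtain E c x y f where p: "p = ((E, c), (x, y, f))" by (metis surj_pair)
    have h: "E \<in> conn_graphs V k" "(x, y, f) \<in> insertions E" "c \<in> even_subs E" "f \<in> c" "card c = l"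
      using that by (auto simp: p P_def marked_def)
    note i = insertion[OF V h(1,2)] and e = insertion_even_sub[OF V h(1-4)]
    have "ins p \<in> Q" unfolding p ins_def Q_def marked_def using i(1,2) e(1,2) h(5) by simp
    moreover have "ext (ins p) = p" unfolding p ins_def ext_def split i(3) e(3) ..
    ultimately show ?thesis ..
  qed
  have ext: "ext q \<in> P \<and> ins (ext q) = q" if "q \<in> Q" for q
  proof -
    obtain E c x y f where q: "q = ((E, c), (x, y, f))" by (metis surj_pair)
    have h: "E \<in> conn_graphs V k" "(x, y, f) \<in> extractions V E" "c \<in> even_subs E" "star x f \<subseteq> c"
        "card c = Suc l"
      using that by (auto simp: q Q_def marked_def)
    note i = extraction[OF V h(1,2)] and e = extraction_even_sub[OF V h(1-4)]
    have "ext q \<in> P" unfolding q ext_def P_def marked_def using i(1,2) e(1,2) h(5) by simp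
    moreover have "ins (ext q) = q" unfolding q ins_def ext_def split i(3) e(3) ..
    ultimately show ?thesis ..
  qed
  have "bij_betw ins P Q"
    by (rule bij_betw_byWitness[where f' = ext]) (use ins ext in auto)
  then have "card P = card Q" by (rule bij_betw_same_card)
  moreover have "finite {(x, y, f) \<in> insertions E. f \<in> c}" if "(E, c) \<in> marked V k l" for E c
  proof (rule finite_subset)
    show "{(x, y, f) \<in> insertions E. f \<in> c} \<subseteq> insertions E" by auto
    show "finite (insertions E)"
      using that by (intro finite_insertions[OF V]) (auto simp: marked_def conn_graphs_def)
  qed
  then have "card P = (\<Sum>(E, c)\<in>marked V k l. card {(x, y, f) \<in> insertions E. f \<in> c})"
    unfolding P_def by (subst card_SigmaI) (auto simp: finite_marked[OF V] intro!: sum.cong)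
  moreover have "finite {(x, y, f) \<in> extractions V E. star x f \<subseteq> c}" for E c
    by (rule finite_subset[OF _ finite_extractions[OF V]]) auto
  then have "card Q = (\<Sum>(E, c)\<in>marked V k (Suc l). card {(x, y, f) \<in> extractions V E. star x f \<subseteq> c})"
    unfolding Q_def by (subst card_SigmaI) (auto simp: finite_marked[OF V] intro!: sum.cong)
  ultimately show ?thesis by simp
qed

text \<open>\<open>f\<close> lies on one side of each bridge, and \<open>y\<close> must be the end
  on that side: every bridge is used in exactly one orientation.\<close>

lemma card_bridge_orientations:
  assumes V: "finite V" and E: "E \<in> conn_graphs V k" and f: "f \<in> nonbridges E"
  shows "card {(x, y). (x, y, f) \<in> insertions E} = card (E - nonbridges E)"
proof (rule bij_betw_same_card)
  have EV: "E \<subseteq> all_edges V" using E by (auto simp: conn_graphs_def)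
  have fV: "f \<in> all_edges V" using f nonbridges_subset EV by blast
  have fE: "f \<in> E" using f nonbridges_subset by blast
  let ?M = "{(x, y). (x, y, f) \<in> insertions E}"
  have no_rev: "(y, x, f) \<notin> insertions E" if m: "(x, y, f) \<in> insertions E" for x y
  proof
    assume m': "(y, x, f) \<in> insertions E"
    obtain S where S: "{x, y} \<in> E" "uncut S (E - {{x, y}})" "x \<in> S" "y \<notin> S" "f \<inter> S = {}"
      using m by (auto simp: insertions_def)
    obtain T where T: "uncut T (E - {{x, y}})" "y \<in> T" "x \<notin> T" "f \<inter> T = {}"
      using m' by (auto simp: insertions_def insert_commute)
    have "E = insert {x, y} (E - {{x, y}})" using S(1) by auto
    \<comment> \<open>\<open>S \<union> T\<close> contains both ends of the bridge, so no edge of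
      \<open>E\<close> leaves it, yet it misses \<open>f\<close>.\<close>
    moreover have "uncut (S \<union> T) (insert {x, y} (E - {{x, y}}))"
      unfolding uncut_insert_doubleton using uncut_Un[OF S(2) T(1)] S T by auto
    ultimately have "uncut (S \<union> T) E" by simp
    then have "V \<subseteq> S \<union> T \<or> V \<inter> (S \<union> T) = {}" using conn_graphsD[OF E] by blast
    moreover have "x \<in> V" using S(1) EV by (auto simp: all_edges_def)
    moreover have "f \<subseteq> V" "f \<noteq> {}" using fV by (auto simp: all_edges_def)
    ultimately show False using S T by auto
  qed
  show "bij_betw (\<lambda>(x, y). {x, y}) ?M (E - nonbridges E)"
  proof (rule bij_betwI')
    fix p q assume "p \<in> ?M" "q \<in> ?M"
    then show "((case p of (x, y) \<Rightarrow> {x, y}) = (case q of (x, y) \<Rightarrow> {x, y})) = (p = q)"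
      using no_rev by (auto simp: doubleton_eq_iff)
  next
    fix p assume "p \<in> ?M"
    then show "(case p of (x, y) \<Rightarrow> {x, y}) \<in> E - nonbridges E"
      by (auto simp: insertions_def nonbridges_doubleton)
  next
    fix e assume e: "e \<in> E - nonbridges E"
    then have "e \<in> all_edges V" using EV by auto
    then obtain S where S: "uncut S (E - {e})" "\<not> (e \<subseteq> S \<or> e \<inter> S = {})"
      using e by (auto simp: nonbridges_def)
    obtain u v where uv: "e = {u, v}" "u \<in> S" "v \<notin> S"
      using \<open>e \<in> all_edges V\<close> S(2) by (elim all_edgesE) auto
    have "f \<in> E - {e}" using e f fE by auto
    then have "f \<subseteq> S \<or> f \<inter> S = {}" using S(1) by (auto simp: uncut_def)
    then have "(u, v, f) \<in> insertions E \<or> (v, u, f) \<in> insertions E"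
    proof
      assume "f \<inter> S = {}"
      then have "(u, v, f) \<in> insertions E" using e uv S f by (auto simp: insertions_def)
      then show ?thesis ..
    next
      assume "f \<subseteq> S"
      then have "f \<inter> - S = {}" by auto
      moreover have "uncut (- S) (E - {{v, u}})" using S(1) uv by (simp add: uncut_Compl insert_commute)
      moreover have "{v, u} \<in> E" using e uv by (auto simp: insert_commute)
      ultimately have "(v, u, f) \<in> insertions E" using uv f unfolding insertions_def by blast
      then show ?thesis ..
    qed
    then show "\<exists>p\<in>?M. e = (case p of (x, y) \<Rightarrow> {x, y})"
      using uv(1) by (auto simp: insert_commute)
  qed
qed

lemma card_insertions:
  assumes V: "finite V" and E: "E \<in> conn_graphs V k" and c: "c \<subseteq> nonbridges E"
  shows "card {(x, y, f) \<in> insertions E. f \<in> c} = card c * card (E - nonbridges E)"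
proof -
  have EV: "E \<subseteq> all_edges V" using E by (auto simp: conn_graphs_def)
  have fc: "finite c" using c nonbridges_subset[of E] finite_edges[OF V EV] by (meson finite_subset)
  have "card {(x, y, f) \<in> insertions E. f \<in> c} = card (Sigma c (\<lambda>f. {(x, y). (x, y, f) \<in> insertions E}))"
    by (rule bij_betw_same_card, rule bij_betw_byWitness[where f = "\<lambda>(x, y, f). (f, x, y)"
        and f' = "\<lambda>(f, x, y). (x, y, f)"]) auto
  also have "\<dots> = (\<Sum>f\<in>c. card {(x, y). (x, y, f) \<in> insertions E})"
  proof (rule card_SigmaI[OF fc], rule ballI)
    fix f
    have "{(x, y). (x, y, f) \<in> insertions E} \<subseteq> V \<times> V" using insertions_subset[OF EV] by auto
    then show "finite {(x, y). (x, y, f) \<in> insertions E}" using V finite_subset by blast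
  qed
  also have "\<dots> = (\<Sum>f\<in>c. card (E - nonbridges E))"
    using card_bridge_orientations[OF V E] c by (intro sum.cong) auto
  finally show ?thesis by simp
qed

text \<open>In an extraction the edges of \<open>star x f\<close> form a cut with two edges. If two
  such cuts at \<open>x\<close> shared just the edge \<open>e\<close>, then \<open>e\<close> would
  be a bridge.\<close>

lemma extraction_unique:
  assumes "(x, y, f) \<in> extractions V E" "(x, y', f') \<in> extractions V E"
    and "e \<in> star x f" "e \<in> star x f'"
  shows "f = f'"
proof -
  obtain S where f: "f \<in> all_edges V" "star x f \<subseteq> nonbridges E"
    and S: "uncut S (E - star x f)" "x \<in> S" "f \<inter> S = {}"
    using assms(1) by (auto simp: extractions_def)
  obtain T where f': "f' \<in> all_edges V" "star x f' \<subseteq> nonbridges E"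
    and T: "uncut T (E - star x f')" "x \<in> T" "f' \<inter> T = {}"
    using assms(2) by (auto simp: extractions_def)
  have "x \<notin> f" "x \<notin> f'" using S T by auto
  obtain a where a: "e = {x, a}" "a \<in> f" using assms(3) by (auto simp: star_def)
  obtain a' where a': "e = {x, a'}" "a' \<in> f'" using assms(4) by (auto simp: star_def)
  have "a \<in> f'" using a a' \<open>x \<notin> f\<close> \<open>x \<notin> f'\<close> by (auto simp: doubleton_eq_iff)
  obtain b where b: "f = {a, b}" "a \<noteq> b"
    using f(1) a(2) by (elim all_edgesE) auto
  obtain d where d: "f' = {a, d}" "a \<noteq> d"
    using f'(1) \<open>a \<in> f'\<close> by (elim all_edgesE) auto
  show ?thesis
  proof (rule ccontr)
    assume "f \<noteq> f'"
    then have "b \<noteq> d" using b d by auto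
    have nb: "{x, a} \<in> nonbridges E" "{x, b} \<in> nonbridges E" "{x, d} \<in> nonbridges E"
      using f(2) f'(2) b d by (auto simp: star_doubleton)
    have ne: "x \<noteq> a" "x \<noteq> b" "x \<noteq> d" using \<open>x \<notin> f\<close> \<open>x \<notin> f'\<close> b d by auto
    have "{x, d} \<in> E - star x f" "{x, b} \<in> E - star x f'"
      using nb nonbridges_subset[of E] b d ne \<open>b \<noteq> d\<close> by (auto simp: star_doubleton doubleton_eq_iff)
    then have "d \<in> S" "b \<in> T" using uncutD[OF S(1)] uncutD[OF T(1)] S(2) T(2) by blast+
    \<comment> \<open>Apart from \<open>{x, a}\<close>, only \<open>{x, b}\<close> can cross
      \<open>S\<close> and only \<open>{x, d}\<close> can cross \<open>T\<close>; both lie inside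
      the union.\<close>
    have "e' \<subseteq> S \<union> T \<or> e' \<inter> (S \<union> T) = {}" if e': "e' \<in> E - {{x, a}}" for e'
    proof (cases "e' \<in> {{x, b}, {x, d}}")
      case True
      then show ?thesis using \<open>d \<in> S\<close> \<open>b \<in> T\<close> S T by auto
    next
      case False
      then have "e' \<subseteq> S \<or> e' \<inter> S = {}" "e' \<subseteq> T \<or> e' \<inter> T = {}"
        using e' S(1) T(1) b d by (auto simp: uncut_def star_doubleton)
      then show ?thesis by blast
    qed
    then have "uncut (S \<union> T) (E - {{x, a}})" by (auto simp: uncut_def)
    then have "a \<in> S \<union> T" using nb(1) S(2) by (auto simp: nonbridges_doubleton)
    then show False using S T b d by auto
  qed
qed

lemma card_star: "card (star x f) = card f" if "x \<notin> f"
  unfolding star_def using that by (intro card_image) (auto simp: inj_on_def doubleton_eq_iff)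

text \<open>By \<open>extraction_unique\<close> each pair of \<open>x\<close> and \<open>f\<close>
  owns two incidences of \<open>c\<close> at \<open>x\<close>, out of \<open>2 * card c\<close> in
  total; the factor \<open>card V\<close> bounds the choices of \<open>y\<close>.\<close>

lemma card_extractions_le:
  assumes V: "finite V" and E: "E \<in> conn_graphs V k" and c: "c \<subseteq> E"
  shows "card {(x, y, f) \<in> extractions V E. star x f \<subseteq> c} \<le> card V * card c"
proof -
  have EV: "E \<subseteq> all_edges V" using E by (auto simp: conn_graphs_def)
  have fc: "finite c" using c finite_edges[OF V EV] by (meson finite_subset)
  define Q where "Q = {(x, f). (\<exists>y. (x, y, f) \<in> extractions V E) \<and> star x f \<subseteq> c}"
  have "Q \<subseteq> V \<times> all_edges V" using extractions_subset by (fastforce simp: Q_def)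
  then have fQ: "finite Q" using V finite_all_edges[OF V] by (meson finite_SigmaI finite_subset)
  have "card (Sigma Q (\<lambda>(x, f). star x f)) \<le> card (Sigma c (\<lambda>e. e))"
  proof (rule card_inj_on_le)
    show "inj_on (\<lambda>((x, f), e). (e, x)) (Sigma Q (\<lambda>(x, f). star x f))"
    proof (rule inj_onI, clarify)
      fix x f e f'
      assume "(x, f) \<in> Q" "(x, f') \<in> Q" "e \<in> star x f" "e \<in> star x f'"
      then show "(x, f) = (x, f') \<and> e = e" using extraction_unique by (fastforce simp: Q_def)
    qed
    show "(\<lambda>((x, f), e). (e, x)) ` Sigma Q (\<lambda>(x, f). star x f) \<subseteq> Sigma c (\<lambda>e. e)"
      by (auto simp: Q_def star_def)
    have "finite e" if "e \<in> c" for e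
      using that c EV V by (auto simp: all_edges_def intro: finite_subset)
    then show "finite (Sigma c (\<lambda>e. e))" using fc by auto
  qed
  also have "card (Sigma Q (\<lambda>(x, f). star x f)) = (\<Sum>(x, f)\<in>Q. card (star x f))"
    using fQ fc by (subst card_SigmaI) (auto simp: Q_def intro: finite_subset intro!: sum.cong)
  also have "\<dots> = (\<Sum>(x, f)\<in>Q. 2)"
  proof (rule sum.cong[OF refl], clarify)
    fix x f assume "(x, f) \<in> Q"
    then have "x \<notin> f" "card f = 2" by (auto simp: Q_def extractions_def all_edges_def)
    then show "card (star x f) = 2" by (simp add: card_star)
  qed
  also have "\<dots> = 2 * card Q" by (simp add: case_prod_unfold)
  also have "card (Sigma c (\<lambda>e. e)) = (\<Sum>e\<in>c. card e)"
    using fc c EV V by (intro card_SigmaI) (auto simp: all_edges_def intro: finite_subset)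
  also have "\<dots> = (\<Sum>e\<in>c. 2)"
    using c EV by (intro sum.cong) (auto simp: all_edges_def)
  finally have "card Q \<le> card c" by simp
  have "card {(x, y, f) \<in> extractions V E. star x f \<subseteq> c} \<le> card (V \<times> Q)"
  proof (rule card_inj_on_le[where f = "\<lambda>(x, y, f). (y, x, f)"])
    show "(\<lambda>(x, y, f). (y, x, f)) ` {(x, y, f) \<in> extractions V E. star x f \<subseteq> c} \<subseteq> V \<times> Q"
      by (auto simp: Q_def extractions_def)
  qed (auto simp: inj_on_def V fQ)
  also have "\<dots> \<le> card V * card c" using \<open>card Q \<le> card c\<close> by (simp add: card_cartesian_product)
  finally show ?thesis .
qed

section \<open>Lower bound for the number of extractions\<close>

lemma deg_mono: "finite E \<Longrightarrow> c \<subseteq> E \<Longrightarrow> deg c v \<le> deg E v"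
  unfolding deg_def by (rule card_mono) auto

text \<open>A count replaces the search for a cycle: if \<open>e\<close> were in no even subgraph,
  \<open>E\<close> and \<open>E - {e}\<close> would have equally many, but both are connected and
  differ by one edge, so the numbers differ by a factor 2.\<close>

lemma nonbridge_in_even_sub:
  assumes V: "finite V" and E: "E \<in> conn_graphs V k" and e: "e \<in> nonbridges E"
  shows "\<exists>c\<in>even_subs E. e \<in> c"
proof (rule ccontr)
  assume neg: "\<not> ?thesis"
  have EV: "E \<subseteq> all_edges V" using E by (auto simp: conn_graphs_def)
  have fE: "finite E" using finite_edges[OF V EV] .
  have eE: "e \<in> E" using e nonbridges_subset by auto
  then have "V \<noteq> {}" using EV by (auto simp: all_edges_def)
  have "even_subs E = even_subs (E - {e})" using neg by (auto simp: even_subs_def)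
  moreover have "2 ^ card V * card (even_subs E) = 2 ^ (card E + 1)"
    using E V \<open>V \<noteq> {}\<close> by (intro card_even_subs_connected) (auto simp: conn_graphs_def)
  moreover have "2 ^ card V * card (even_subs (E - {e})) = 2 ^ (card (E - {e}) + 1)"
  proof (intro card_even_subs_connected V \<open>V \<noteq> {}\<close>)
    fix S assume S: "S \<subseteq> V" "uncut S (E - {e})"
    then have "uncut S E" using e by (auto simp: nonbridges_def uncut_def)
    then show "S = {} \<or> S = V" using S E by (auto simp: conn_graphs_def)
  qed (use EV in auto)
  ultimately have "(2::nat) ^ (card E + 1) = 2 ^ (card (E - {e}) + 1)" by simp
  moreover have "card E = card (E - {e}) + 1" using eE fE by (metis Suc_eq_plus1 card.remove)
  ultimately show False by simp
qed

lemma deg_nonbridges_ge_2: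
  assumes V: "finite V" and E: "E \<in> conn_graphs V k" and e: "e \<in> nonbridges E" "v \<in> e"
  shows "2 \<le> deg (nonbridges E) v"
proof -
  have EV: "E \<subseteq> all_edges V" using E by (auto simp: conn_graphs_def)
  have fn: "finite (nonbridges E)"
    using finite_edges[OF V EV] nonbridges_subset[of E] by (meson finite_subset)
  obtain c where c: "c \<in> even_subs E" "e \<in> c" using nonbridge_in_even_sub[OF V E e(1)] by auto
  have cn: "c \<subseteq> nonbridges E" using even_sub_nonbridges[OF V EV c(1)] .
  have "finite c" using cn fn finite_subset by blast
  then have "deg c v \<noteq> 0" using c e(2) by (auto simp: deg_def card_eq_0_iff)
  moreover have "even (deg c v)" using c by (auto simp: even_subs_def)
  ultimately have "2 \<le> deg c v" by presburger
  then show ?thesis using deg_mono[OF fn cn, of v] by simp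
qed

text \<open>\<open>U\<close> grows to \<open>V\<close> one vertex at a time; each new vertex is
  reached by an edge that then falls inside the enlarged set, so the edges used are
  distinct.\<close>

lemma card_edges_outside:
  assumes V: "finite V" and E: "E \<in> conn_graphs V k" and U: "U \<subseteq> V" "U \<noteq> {}"
  shows "card (V - U) \<le> card {e \<in> E. \<not> e \<subseteq> U}"
  using U
proof (induction "card (V - U)" arbitrary: U)
  case 0
  then show ?case by simp
next
  case (Suc n)
  have EV: "E \<subseteq> all_edges V" using E by (auto simp: conn_graphs_def)
  have fE: "finite E" using finite_edges[OF V EV] .
  have "U \<noteq> V" using Suc.hyps(2) by auto
  then have "\<not> uncut U E" using Suc.prems E by (auto simp: conn_graphs_def)
  then obtain e where e: "e \<in> E" "\<not> e \<subseteq> U" "e \<inter> U \<noteq> {}" by (auto simp: uncut_def)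
  have "e \<in> all_edges V" using e EV by auto
  then obtain u v where uv: "e = {u, v}" "u \<in> U" "v \<in> V - U"
    using e by (elim all_edgesE) auto
  have "card (V - insert v U) = n"
  proof -
    have "V - insert v U = V - U - {v}" by auto
    moreover have "card (V - U - {v}) = card (V - U) - 1" using uv(3) by (rule card_Diff_singleton)
    ultimately show ?thesis using Suc.hyps(2) by simp
  qed
  then have "n \<le> card {e \<in> E. \<not> e \<subseteq> insert v U}"
    using Suc.hyps(1)[of "insert v U"] Suc.prems uv(3) by auto
  also have "\<dots> < card {e \<in> E. \<not> e \<subseteq> U}"
  proof (rule psubset_card_mono)
    have "{e \<in> E. \<not> e \<subseteq> insert v U} \<subseteq> {e \<in> E. \<not> e \<subseteq> U}" by auto
    moreover have "e \<notin> {e \<in> E. \<not> e \<subseteq> insert v U}" using uv(1,2) by simp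
    moreover have "e \<in> {e \<in> E. \<not> e \<subseteq> U}" using e(1,2) by simp
    ultimately show "{e \<in> E. \<not> e \<subseteq> insert v U} \<subset> {e \<in> E. \<not> e \<subseteq> U}"
      by (metis psubsetI)
  qed (use fE in auto)
  finally show ?case using Suc.hyps(2) by simp
qed

text \<open>The vertices outside the nonbridges consume at least as many bridges
  (\<open>card_edges_outside\<close>); the excess of edges over vertices is thus left to the
  nonbridges, even if they form several components.\<close>

lemma card_nonbridges_le:
  assumes V: "finite V" and E: "E \<in> conn_graphs V k" and ne: "nonbridges E \<noteq> {}"
  shows "card (nonbridges E) \<le> card (\<Union>(nonbridges E)) + k"
proof -
  let ?H = "nonbridges E" let ?U = "\<Union>?H"
  have EV: "E \<subseteq> all_edges V" and cE: "card E + 1 = card V + k" using E by (auto simp: conn_graphs_def)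
  have fE: "finite E" using finite_edges[OF V EV] .
  have HE: "?H \<subseteq> E" by (rule nonbridges_subset)
  have UV: "?U \<subseteq> V" using HE EV by (auto simp: all_edges_def)
  obtain e where "e \<in> ?H" using ne by auto
  then have "?U \<noteq> {}" using HE EV by (force simp: all_edges_def)
  then have "card (V - ?U) \<le> card {e \<in> E. \<not> e \<subseteq> ?U}" using card_edges_outside[OF V E UV] by blast
  also have "\<dots> \<le> card (E - ?H)" using fE by (intro card_mono) auto
  also have "\<dots> = card E - card ?H" using fE HE by (intro card_Diff_subset) (auto intro: finite_subset)
  finally have "card V - card ?U \<le> card E - card ?H"
    using UV V by (simp add: card_Diff_subset finite_subset)
  moreover have "card ?H \<le> card E" using fE HE by (rule card_mono)
  moreover have "card ?U \<le> card V" using V UV by (rule card_mono)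
  ultimately show ?thesis using cE by linarith
qed

text \<open>
  Handshake: \<open>deg - 2\<close> sums to at most \<open>2 * k\<close> over the graph of nonbridges, so at most \<open>6 * k\<close>
  incidences of \<open>c\<close> are at vertices of degree three or more.
\<close>

lemma card_degree_two:
  assumes V: "finite V" and E: "E \<in> conn_graphs V k" and c: "c \<subseteq> nonbridges E"
    and c2: "\<And>v. deg (nonbridges E) v = 2 \<Longrightarrow> deg c v = 0 \<or> deg c v = 2"
  shows "card c \<le> card {v \<in> V. deg (nonbridges E) v = 2 \<and> deg c v = 2} + 3 * k"
proof (cases "nonbridges E = {}")
  case True
  then show ?thesis using c by simp
next
  case False
  let ?H = "nonbridges E"
  define U where "U = \<Union>?H"
  let ?D2 = "{v \<in> U. deg ?H v = 2}" let ?D3 = "{v \<in> U. deg ?H v \<noteq> 2}"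
  have EV: "E \<subseteq> all_edges V" using E by (auto simp: conn_graphs_def)
  have fE: "finite E" using finite_edges[OF V EV] .
  have HE: "?H \<subseteq> E" by (rule nonbridges_subset)
  have fH: "finite ?H" using fE HE finite_subset by blast
  have fc: "finite c" using fH c finite_subset by blast
  have UV: "U \<subseteq> V" using HE EV by (auto simp: U_def all_edges_def)
  have fU: "finite U" using UV V finite_subset by blast
  have handshake: "(\<Sum>v\<in>U. deg d v) = 2 * card d" if "d \<subseteq> ?H" for d
  proof -
    have "(\<Sum>v\<in>U. deg d v) = (\<Sum>e\<in>d. card (U \<inter> e))"
      using that fH fU finite_subset by (intro sum_deg) auto
    also have "\<dots> = (\<Sum>e\<in>d. 2)"
    proof (rule sum.cong[OF refl])
      fix e assume e: "e \<in> d"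
      then have "U \<inter> e = e" using that e by (auto simp: U_def)
      moreover have "card e = 2" using e that HE EV by (auto simp: all_edges_def)
      ultimately show "card (U \<inter> e) = 2" by simp
    qed
    finally show ?thesis by simp
  qed
  have ge2: "2 \<le> deg ?H v" if "v \<in> U" for v
    using deg_nonbridges_ge_2[OF V E] that by (auto simp: U_def)
  have split: "(\<Sum>v\<in>U. g v) = (\<Sum>v\<in>?D2. g v) + (\<Sum>v\<in>?D3. g v)" for g :: "'a \<Rightarrow> nat"
    using fU by (subst sum.union_disjoint[symmetric]) (auto intro!: sum.cong)
  \<comment> \<open>For a degree \<open>d\<close> of at least three,
    \<open>d \<le> 3 * (d - 2)\<close>; this triples the handshake bound
    \<open>2 * k\<close>.\<close>
  have "(\<Sum>v\<in>?D3. deg ?H v) \<le> (\<Sum>v\<in>?D3. 3 * (deg ?H v - 2))"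
    using ge2 by (intro sum_mono) fastforce
  also have "\<dots> \<le> (\<Sum>v\<in>U. 3 * (deg ?H v - 2))"
    using fU by (intro sum_mono2) auto
  also have "\<dots> = 3 * (\<Sum>v\<in>U. deg ?H v - 2)" by (rule sum_distrib_left[symmetric])
  also have "(\<Sum>v\<in>U. deg ?H v - 2) = (\<Sum>v\<in>U. deg ?H v) - (\<Sum>v\<in>U. 2)"
    using ge2 by (rule sum_subtractf_nat)
  also have "3 * \<dots> = 6 * card ?H - 6 * card U" using handshake[of ?H] by simp
  also have "\<dots> \<le> 6 * k" using card_nonbridges_le[OF V E False] by (simp add: U_def)
  finally have D3: "(\<Sum>v\<in>?D3. deg ?H v) \<le> 6 * k" .
  have "2 * card c = (\<Sum>v\<in>?D2. deg c v) + (\<Sum>v\<in>?D3. deg c v)"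
    using handshake[OF c] split[of "deg c"] by simp
  also have "(\<Sum>v\<in>?D3. deg c v) \<le> (\<Sum>v\<in>?D3. deg ?H v)"
    using deg_mono[OF fH c] by (intro sum_mono)
  also have "(\<Sum>v\<in>?D2. deg c v) = (\<Sum>v\<in>?D2. if deg c v = 2 then 2 else 0)"
    using c2 by (intro sum.cong) auto
  also have "\<dots> = 2 * card {v \<in> ?D2. deg c v = 2}"
    using fU by (subst sum.inter_filter[symmetric]) auto
  also have "card {v \<in> ?D2. deg c v = 2} \<le> card {v \<in> V. deg ?H v = 2 \<and> deg c v = 2}"
    using V UV by (intro card_mono) auto
  finally show ?thesis using D3 by simp
qed

text \<open>The connected component as the least uncut set around \<open>x\<close>, which avoids
  paths.\<close>

definition component :: "'a set set \<Rightarrow> 'a \<Rightarrow> 'a set" where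
  "component E x = \<Inter>{S. x \<in> S \<and> uncut S E}"

lemma component_self: "x \<in> component E x"
  by (auto simp: component_def)

lemma component_least: "x \<in> S \<Longrightarrow> uncut S E \<Longrightarrow> component E x \<subseteq> S"
  by (auto simp: component_def)

lemma uncut_component: "uncut (component E x) E"
  unfolding uncut_def
proof
  fix e assume e: "e \<in> E"
  show "e \<subseteq> component E x \<or> e \<inter> component E x = {}"
  proof (cases "\<forall>S. x \<in> S \<and> uncut S E \<longrightarrow> e \<subseteq> S")
    case True
    then show ?thesis by (auto simp: component_def)
  next
    case False
    then obtain S where "x \<in> S" "uncut S E" "\<not> e \<subseteq> S" by auto
    then have "e \<inter> S = {}" "component E x \<subseteq> S" using e by (auto simp: uncut_def component_def)
    then show ?thesis by auto
  qed
qed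

text \<open>Only neighbours along nonbridges. If there are two of them, this set is itself the edge
  \<open>f\<close> of an extraction at \<open>x\<close>.\<close>

definition nbrs :: "'a set set \<Rightarrow> 'a \<Rightarrow> 'a set" where
  "nbrs E x = {a. {x, a} \<in> nonbridges E}"

lemma nbrs_facts:
  assumes "E \<subseteq> all_edges V"
  shows "x \<notin> nbrs E x" "star x (nbrs E x) = {e \<in> nonbridges E. x \<in> e}"
    "card (nbrs E x) = deg (nonbridges E) x" "nbrs E x \<subseteq> V"
proof -
  have NV: "nonbridges E \<subseteq> all_edges V" using assms nonbridges_subset by blast
  show 1: "x \<notin> nbrs E x" using NV by (auto simp: nbrs_def all_edges_def)
  show 2: "star x (nbrs E x) = {e \<in> nonbridges E. x \<in> e}"
  proof
    show "star x (nbrs E x) \<subseteq> {e \<in> nonbridges E. x \<in> e}" by (auto simp: star_def nbrs_def)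
    show "{e \<in> nonbridges E. x \<in> e} \<subseteq> star x (nbrs E x)"
    proof
      fix e assume e: "e \<in> {e \<in> nonbridges E. x \<in> e}"
      then have "e \<in> all_edges V" using NV by auto
      then obtain a where "e = {x, a}" using e by (elim all_edgesE) (auto simp: insert_commute)
      then show "e \<in> star x (nbrs E x)" using e by (auto simp: star_def nbrs_def)
    qed
  qed
  show "card (nbrs E x) = deg (nonbridges E) x" using card_star[OF 1] by (simp add: 2 deg_def)
  show "nbrs E x \<subseteq> V" using NV by (auto simp: nbrs_def all_edges_def)
qed

text \<open>
  At a vertex \<open>x\<close> of degree two in the graph of nonbridges, this is the part of the graph that an
  extraction moves along with \<open>x\<close>.
\<close>

definition hanging :: "'a set set \<Rightarrow> 'a \<Rightarrow> 'a set" where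
  "hanging E x = component (E - star x (nbrs E x)) x"

text \<open>After removal of the star only bridges remain at \<open>x\<close>. The cut of such a
  bridge keeps \<open>x\<close> and \<open>a\<close> together, hence also everything joined to
  \<open>a\<close> while avoiding \<open>x\<close>, and so excludes the far end of the bridge.
  Therefore the component \<open>A\<close> of \<open>a\<close> in the graph without \<open>x\<close>
  is never entered from \<open>x\<close>.\<close>

lemma hanging_nbrs:
  assumes EV: "E \<subseteq> all_edges V"
  shows "nbrs E x \<inter> hanging E x = {}"
proof -
  have "a \<notin> hanging E x" if a: "a \<in> nbrs E x" for a
  proof -
    define F where "F = {e \<in> E. x \<notin> e}"
    define A where "A = component F a"
    have "a \<noteq> x" using nbrs_facts(1)[OF EV] a by auto
    moreover have "uncut (- {x}) F" by (auto simp: uncut_def F_def)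
    ultimately have "x \<notin> A" using component_least[of a "- {x}" F] by (auto simp: A_def)
    have xa: "{x, a} \<in> nonbridges E" using a by (simp add: nbrs_def)
    have "uncut (- A) (E - star x (nbrs E x))"
      unfolding uncut_Compl
    proof -
      have "e \<subseteq> A \<or> e \<inter> A = {}" if e: "e \<in> E" "e \<notin> star x (nbrs E x)" for e
      proof (cases "x \<in> e")
        case False
        then have "e \<in> F" using e by (simp add: F_def)
        then show ?thesis using uncut_component[of F a] by (auto simp: A_def uncut_def)
      next
        case True
        have "e \<in> all_edges V" using e EV by auto
        then obtain z where z: "e = {x, z}" using True by (elim all_edgesE) (auto simp: insert_commute)
        have "e \<notin> nonbridges E" using e True nbrs_facts(2)[OF EV, of x] by auto
        then obtain Z where Z: "uncut Z (E - {e})" "(x \<in> Z) \<noteq> (z \<in> Z)"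
          using e unfolding z nonbridges_doubleton by blast
        have "{x, a} \<in> E - {e}" using xa \<open>e \<notin> nonbridges E\<close> nonbridges_subset by auto
        then have aZ: "a \<in> Z \<longleftrightarrow> x \<in> Z" using uncutD[OF Z(1)] by auto
        have "uncut Z F" "uncut (- Z) F" using Z(1) True by (auto simp: uncut_Compl F_def elim!: uncut_mono)
        then have "a \<in> Z \<Longrightarrow> A \<subseteq> Z" "a \<notin> Z \<Longrightarrow> A \<subseteq> - Z"
          using component_least[of a _ F] by (auto simp: A_def)
        then have "z \<notin> A" using Z(2) aZ by auto
        then show ?thesis using z \<open>x \<notin> A\<close> by auto
      qed
      then show "uncut A (E - star x (nbrs E x))" by (auto simp: uncut_def)
    qed
    then have "hanging E x \<subseteq> - A" using \<open>x \<notin> A\<close> unfolding hanging_def by (intro component_least) auto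
    then show ?thesis using component_self[of a F] by (auto simp: A_def)
  qed
  then show ?thesis by auto
qed

text \<open>A star edge meets the set hanging at its centre only in the centre, which is not in the
  other set; hence no edge at all leaves the intersection, and connectivity makes it
  trivial.\<close>

lemma hanging_disjoint:
  assumes E: "E \<in> conn_graphs V k" and x: "x \<in> V"
    and T: "x' \<notin> hanging E x" "x \<notin> hanging E x'"
  shows "V \<inter> hanging E x \<inter> hanging E x' = {}"
proof -
  let ?Z = "hanging E x \<inter> hanging E x'"
  have EV: "E \<subseteq> all_edges V" using E by (auto simp: conn_graphs_def)
  have "e \<subseteq> ?Z \<or> e \<inter> ?Z = {}" if e: "e \<in> E" for e
  proof (cases "e \<in> star x (nbrs E x) \<union> star x' (nbrs E x')")
    case True
    then obtain a where "e = {x, a} \<and> a \<in> nbrs E x \<or> e = {x', a} \<and> a \<in> nbrs E x'"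
      by (auto simp: star_def)
    moreover have "a \<notin> hanging E x" if "a \<in> nbrs E x" for a x
      using hanging_nbrs[OF EV, of x] that by blast
    ultimately have "e \<inter> ?Z = {}" using T by blast
    then show ?thesis ..
  next
    case False
    then have "e \<subseteq> hanging E x \<or> e \<inter> hanging E x = {}" "e \<subseteq> hanging E x' \<or> e \<inter> hanging E x' = {}"
      using e uncut_component[of "E - star x (nbrs E x)" x] uncut_component[of "E - star x' (nbrs E x')" x']
      by (auto simp: uncut_def hanging_def)
    then show ?thesis by blast
  qed
  then have "uncut ?Z E" by (auto simp: uncut_def)
  then have "V \<subseteq> ?Z \<or> V \<inter> ?Z = {}" by (rule conn_graphsD[OF E])
  then show ?thesis
  proof
    assume "V \<subseteq> ?Z"
    then show ?thesis using x T(2) by (metis IntD2 subsetD)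
  next
    assume "V \<inter> ?Z = {}"
    then show ?thesis by (simp only: Int_assoc)
  qed
qed

text \<open>
  The sets \<open>hanging E x\<close> may overlap (two cycles joined by a path), but those containing a given
  vertex have distinct witnesses \<open>c\<close> below, hence there are at most \<open>2 ^ k\<close> of them.
\<close>

lemma cycle_avoiding_hanging:
  assumes V: "finite V" and E: "E \<in> conn_graphs V k" and x: "deg (nonbridges E) x = 2"
  shows "\<exists>c\<in>even_subs E. deg c x \<noteq> 0 \<and> (\<forall>v\<in>hanging E x - {x}. deg c v = 0)"
proof -
  have EV: "E \<subseteq> all_edges V" using E by (auto simp: conn_graphs_def)
  have fE: "finite E" using finite_edges[OF V EV] .
  let ?T = "hanging E x"
  have "{e \<in> nonbridges E. x \<in> e} \<noteq> {}"
    using x unfolding deg_def by (metis card.empty zero_neq_numeral)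
  then obtain e where e: "e \<in> nonbridges E" "x \<in> e" by auto
  obtain c where c: "c \<in> even_subs E" "e \<in> c" using nonbridge_in_even_sub[OF V E e(1)] by auto
  have cH: "c \<subseteq> nonbridges E" using even_sub_nonbridges[OF V EV c(1)] .
  have cE: "c \<subseteq> E" using c by (auto simp: even_subs_def)
  have fc: "finite c" using cE fE finite_subset by blast
  \<comment> \<open>Every edge of \<open>c\<close> at \<open>x\<close> leaves the hanging set, and
    every edge of \<open>c\<close> at another vertex of that set stays inside. Dropping the inner
    edges thus makes degrees zero there and preserves all others.\<close>
  define d where "d = {e \<in> c. \<not> e \<subseteq> ?T}"
  have in_T: "e' \<subseteq> ?T" if "e' \<in> c" "v \<in> e'" "v \<in> ?T" "v \<noteq> x" for e' v
  proof -
    have "e' \<notin> star x (nbrs E x)" using that hanging_nbrs[OF EV, of x] by (auto simp: star_def)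
    then show ?thesis
      using that cE uncut_component[of "E - star x (nbrs E x)" x] by (auto simp: uncut_def hanging_def)
  qed
  have zero: "deg d v = 0" if "v \<in> ?T" "v \<noteq> x" for v
  proof -
    have "{e \<in> d. v \<in> e} = {}" using in_T that by (auto simp: d_def)
    then show ?thesis by (simp only: deg_def card.empty)
  qed
  have same: "deg d v = deg c v" if "v \<notin> ?T \<or> v = x" for v
  proof -
    have "\<not> e' \<subseteq> ?T" if e': "e' \<in> c" "x \<in> e'" for e'
    proof -
      have "e' \<in> star x (nbrs E x)" using e' cH nbrs_facts(2)[OF EV, of x] by auto
      then show ?thesis using hanging_nbrs[OF EV, of x] by (auto simp: star_def)
    qed
    then have "{e \<in> d. v \<in> e} = {e \<in> c. v \<in> e}" using that by (auto simp: d_def)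
    then show ?thesis by (simp add: deg_def)
  qed
  have "even (deg d v)" for v
    using zero[of v] same[of v] c(1) by (cases "v \<notin> ?T \<or> v = x") (auto simp: even_subs_def)
  then have "d \<in> even_subs E" using cE by (auto simp: even_subs_def d_def)
  moreover have "deg d x \<noteq> 0" using same[of x] c e fc by (auto simp: deg_def card_eq_0_iff)
  ultimately show ?thesis using zero by blast
qed

text \<open>If the sets hanging at two vertices share \<open>v\<close>, one of the vertices lies in
  the set of the other (\<open>hanging_disjoint\<close>). The witness of the latter avoids the
  former, so the witnesses differ and inject into the \<open>2 ^ k\<close> even subgraphs.\<close>

lemma card_hanging_through:
  assumes V: "finite V" "V \<noteq> {}" and E: "E \<in> conn_graphs V k" and v: "v \<in> V"
  shows "card {x \<in> V. deg (nonbridges E) x = 2 \<and> v \<in> hanging E x} \<le> 2 ^ k"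
proof -
  let ?X = "{x \<in> V. deg (nonbridges E) x = 2 \<and> v \<in> hanging E x}"
  have EV: "E \<subseteq> all_edges V" using E by (auto simp: conn_graphs_def)
  define C where "C x = (SOME c. c \<in> even_subs E \<and> deg c x \<noteq> 0 \<and> (\<forall>v\<in>hanging E x - {x}. deg c v = 0))" for x
  have C: "C x \<in> even_subs E \<and> deg (C x) x \<noteq> 0 \<and> (\<forall>v\<in>hanging E x - {x}. deg (C x) v = 0)"
    if "x \<in> ?X" for x
    unfolding C_def using cycle_avoiding_hanging[OF V(1) E, of x] that
    by (intro someI_ex[of "\<lambda>c. c \<in> even_subs E \<and> _ c"]) auto
  have "inj_on C ?X"
  proof (rule inj_onI, rule ccontr)
    fix x x' assume x: "x \<in> ?X" "x' \<in> ?X" "C x = C x'" "x \<noteq> x'"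
    have "x' \<in> hanging E x \<or> x \<in> hanging E x'"
      using hanging_disjoint[OF E, of x x'] x v by auto
    then show False using C[OF x(1)] C[OF x(2)] x(3,4) by auto
  qed
  then have "card ?X \<le> card (even_subs E)"
    using C finite_even_subs[OF finite_edges[OF V(1) EV]] by (intro card_inj_on_le) auto
  then show ?thesis using card_even_subs[OF V E] by simp
qed

text \<open>At these vertices an extraction would create a double edge. Each lies on a triangle,
  triangles are even subgraphs, and each accounts for three vertices.\<close>

lemma card_in_triangle:
  assumes V: "finite V" "V \<noteq> {}" and E: "E \<in> conn_graphs V k"
  shows "card {x \<in> V. deg (nonbridges E) x = 2 \<and> nbrs E x \<in> E} \<le> 3 * 2 ^ k"
proof -
  let ?X = "{x \<in> V. deg (nonbridges E) x = 2 \<and> nbrs E x \<in> E}"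
  define C where "C = {c \<in> even_subs E. card (\<Union>c) = 3}"
  have EV: "E \<subseteq> all_edges V" using E by (auto simp: conn_graphs_def)
  have fC: "finite C" using finite_even_subs[OF finite_edges[OF V(1) EV]] by (auto simp: C_def)
  have "?X \<subseteq> (\<Union>c\<in>C. \<Union>c)"
  proof
    fix x assume x: "x \<in> ?X"
    have "card (nbrs E x) = 2" using x nbrs_facts(3)[OF EV] by simp
    then obtain a b where ab: "nbrs E x = {a, b}" "a \<noteq> b" by (auto simp: card_2_iff)
    have ne: "x \<noteq> a" "x \<noteq> b" using nbrs_facts(1)[OF EV, of x] ab by auto
    have xE: "{x, a} \<in> E" "{x, b} \<in> E" "{a, b} \<in> E"
      using ab x nonbridges_subset[of E] by (auto simp: nbrs_def)
    let ?c = "{{x, a}, {x, b}, {a, b}}"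
    have d: "{x, a} \<noteq> {x, b}" "{x, a} \<noteq> {a, b}" "{x, b} \<noteq> {a, b}"
      using ab ne by (auto simp: doubleton_eq_iff)
    have "even (deg ?c v)" for v
      using d ab ne by (simp add: deg_insert) (simp add: deg_def)
    then have "?c \<in> even_subs E" using xE by (auto simp: even_subs_def)
    moreover have "\<Union>?c = {x, a, b}" by auto
    then have "card (\<Union>?c) = 3" using ne ab by simp
    ultimately have "?c \<in> C" by (simp only: C_def mem_Collect_eq)
    then show "x \<in> (\<Union>c\<in>C. \<Union>c)" by blast
  qed
  moreover have "finite (\<Union>c)" if "c \<in> C" for c
    using that card_ge_0_finite[of "\<Union>c"] by (simp add: C_def)
  then have "finite (\<Union>c\<in>C. \<Union>c)" by (rule finite_UN_I[OF fC])
  ultimately have "card ?X \<le> card (\<Union>c\<in>C. \<Union>c)" by (intro card_mono)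
  also have "\<dots> \<le> (\<Sum>c\<in>C. card (\<Union>c))" by (rule card_UN_le[OF fC])
  also have "\<dots> = 3 * card C" by (simp add: C_def)
  also have "card C \<le> card (even_subs E)"
    using finite_even_subs[OF finite_edges[OF V(1) EV]] by (intro card_mono) (auto simp: C_def)
  also have "\<dots> = 2 ^ k" using card_even_subs[OF V E] .
  finally show ?thesis by simp
qed

text \<open>The constant collects \<open>3 * k\<close> for vertices of higher degree,
  \<open>3 * 2 ^ k\<close> for triangles and \<open>2 ^ k\<close> for forbidden targets
  \<open>y\<close>. The condition on degrees holds both for even subgraphs and for the set of all
  nonbridges.\<close>

lemma card_extractions_ge:
  assumes V: "finite V" "V \<noteq> {}" and E: "E \<in> conn_graphs V k" and c: "c \<subseteq> nonbridges E"
    and c2: "\<And>v. deg (nonbridges E) v = 2 \<Longrightarrow> deg c v = 0 \<or> deg c v = 2"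
  shows "card V * card c \<le>
    card {(x, y, f) \<in> extractions V E. star x f \<subseteq> c} + card V * (3 * k + 4 * 2 ^ k)"
proof -
  let ?M = "{(x, y, f) \<in> extractions V E. star x f \<subseteq> c}"
  have EV: "E \<subseteq> all_edges V" using E by (auto simp: conn_graphs_def)
  have fH: "finite (nonbridges E)"
    using finite_edges[OF V(1) EV] nonbridges_subset[of E] by (meson finite_subset)
  define X where "X = {v \<in> V. deg (nonbridges E) v = 2 \<and> deg c v = 2}"
  define Y where "Y = {x \<in> X. nbrs E x \<notin> E}"
  have fX: "finite X" "finite Y" using V by (auto simp: X_def Y_def)
  \<comment> \<open>The witness is \<open>S = hanging E x\<close>; every \<open>y\<close> outside it
    is allowed.\<close>
  have mem: "(x, y, nbrs E x) \<in> ?M" if x: "x \<in> Y" and y: "y \<in> V - hanging E x" for x y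
  proof -
    have x2: "x \<in> V" "deg (nonbridges E) x = 2" "deg c x = 2" "nbrs E x \<notin> E"
      using x by (auto simp: X_def Y_def)
    have "{e \<in> c. x \<in> e} = {e \<in> nonbridges E. x \<in> e}"
      using x2 c fH by (intro card_subset_eq) (auto simp: deg_def)
    then have "star x (nbrs E x) \<subseteq> c" using nbrs_facts(2)[OF EV, of x] by auto
    moreover have "nbrs E x \<in> all_edges V"
      using nbrs_facts(3,4)[OF EV, of x] x2 by (simp add: all_edges_def)
    moreover have "star x (nbrs E x) \<subseteq> nonbridges E" using nbrs_facts(2)[OF EV, of x] by auto
    ultimately show ?thesis
      using x2 y hanging_nbrs[OF EV, of x] uncut_component[of "E - star x (nbrs E x)" x]
        component_self[of x "E - star x (nbrs E x)"]
      unfolding extractions_def hanging_def by blast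
  qed
  have "card (Sigma Y (\<lambda>x. V - hanging E x)) \<le> card ?M"
  proof (rule card_inj_on_le[where f = "\<lambda>(x, y). (x, y, nbrs E x)"])
    show "(\<lambda>(x, y). (x, y, nbrs E x)) ` Sigma Y (\<lambda>x. V - hanging E x) \<subseteq> ?M"
      using mem by auto
    show "finite ?M" by (rule finite_subset[OF _ finite_extractions[OF V(1)]]) auto
  qed (auto simp: inj_on_def)
  moreover have "card (Sigma Y (\<lambda>x. V - hanging E x)) = (\<Sum>x\<in>Y. card (V - hanging E x))"
    using fX V by (intro card_SigmaI) auto
  moreover have "(\<Sum>x\<in>Y. card (V - hanging E x)) + (\<Sum>x\<in>Y. card (V \<inter> hanging E x)) = card Y * card V"
  proof -
    have "card (V - hanging E x) + card (V \<inter> hanging E x) = card V" for x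
      using V(1) by (metis card_Int_Diff add.commute)
    then show ?thesis by (simp add: sum.distrib[symmetric])
  qed
  \<comment> \<open>A single hanging set may be large, so the sizes are bounded only in total, by
    counting for each \<open>v\<close> the sets through it.\<close>
  moreover have "(\<Sum>x\<in>Y. card (V \<inter> hanging E x)) \<le> card V * 2 ^ k"
  proof -
    have "(\<Sum>x\<in>Y. card (V \<inter> hanging E x)) = (\<Sum>x\<in>Y. \<Sum>v\<in>V. if v \<in> hanging E x then 1 else 0)"
      using V(1) by (simp add: sum.If_cases)
    also have "\<dots> = (\<Sum>v\<in>V. \<Sum>x\<in>Y. if v \<in> hanging E x then 1 else 0)" by (rule sum.swap)
    also have "\<dots> = (\<Sum>v\<in>V. card {x \<in> Y. v \<in> hanging E x})"
      using fX by (simp add: sum.If_cases Collect_conj_eq)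
    also have "\<dots> \<le> (\<Sum>v\<in>V. 2 ^ k)"
    proof (rule sum_mono)
      fix v assume v: "v \<in> V"
      have "card {x \<in> Y. v \<in> hanging E x} \<le> card {x \<in> V. deg (nonbridges E) x = 2 \<and> v \<in> hanging E x}"
        using V(1) by (intro card_mono) (auto simp: X_def Y_def)
      then show "card {x \<in> Y. v \<in> hanging E x} \<le> 2 ^ k"
        using card_hanging_through[OF V E v] by simp
    qed
    finally show ?thesis by simp
  qed
  ultimately have 1: "card Y * card V \<le> card ?M + card V * 2 ^ k" by linarith
  have "card X = card Y + card (X - Y)" using fX by (subst card_Diff_subset) (auto simp: Y_def card_mono)
  moreover have "card (X - Y) \<le> card {x \<in> V. deg (nonbridges E) x = 2 \<and> nbrs E x \<in> E}"
    using V(1) by (intro card_mono) (auto simp: X_def Y_def)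
  moreover have "\<dots> \<le> 3 * 2 ^ k" by (rule card_in_triangle[OF V E])
  moreover have "card c \<le> card X + 3 * k"
    using card_degree_two[OF V(1) E c c2] by (simp add: X_def)
  ultimately have "card c \<le> card Y + (3 * k + 3 * 2 ^ k)" by linarith
  then have "card V * card c \<le> card V * (card Y + (3 * k + 3 * 2 ^ k))" by (rule mult_le_mono2)
  also have "\<dots> = card Y * card V + card V * (3 * k + 3 * 2 ^ k)" by (simp add: algebra_simps)
  also have "\<dots> \<le> card ?M + card V * 2 ^ k + card V * (3 * k + 3 * 2 ^ k)" using 1 by simp
  also have "\<dots> = card ?M + card V * (3 * k + 4 * 2 ^ k)" by (simp add: algebra_simps)
  finally show ?thesis .
qed

section \<open>The recursion for marked graphs\<close>

text \<open>Insertions number \<open>h * (n - 1 + k - h)\<close> and extractions at least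
  \<open>n * h - n * B\<close>, with equal totals. The terms \<open>n * h\<close> cancel and
  \<open>h ^ 2\<close> is left against \<open>(k - 1) * h + n * B\<close>.\<close>

lemma sum_card_nonbridges_square:
  assumes V: "finite V" "V \<noteq> {}"
  shows "(\<Sum>E\<in>conn_graphs V k. real (card (nonbridges E)) ^ 2) \<le>
    real (card V) * real (k * (k + 1) + 3 * k + 4 * 2 ^ k) * real (card (conn_graphs V k))"
proof -
  let ?n = "real (card V)" and ?G = "conn_graphs V k" and ?h = "\<lambda>E. real (card (nonbridges E))"
  let ?B = "real (3 * k + 4 * 2 ^ k)"
  have n1: "1 \<le> ?n" using V by (simp add: card_gt_0_iff Suc_le_eq)
  have G: "E \<subseteq> all_edges V" "finite E" "real (card E) = ?n - 1 + k" "?h E \<le> ?n + k"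
      "real (card (E - nonbridges E)) = ?n - 1 + k - ?h E" if E: "E \<in> ?G" for E
  proof -
    show EV: "E \<subseteq> all_edges V" using E by (auto simp: conn_graphs_def)
    show fE: "finite E" using finite_edges[OF V(1) EV] .
    have "card E + 1 = card V + k" using E by (auto simp: conn_graphs_def)
    then show cE: "real (card E) = ?n - 1 + k" by linarith
    have le: "card (nonbridges E) \<le> card E" using fE nonbridges_subset by (rule card_mono)
    then show "?h E \<le> ?n + k" using cE by linarith
    have "card (E - nonbridges E) = card E - card (nonbridges E)"
      using fE nonbridges_subset by (intro card_Diff_subset) (auto intro: finite_subset)
    then show "real (card (E - nonbridges E)) = ?n - 1 + k - ?h E" using le cE by simp
  qed
  have ext: "card V * card (nonbridges E) \<le> card (extractions V E) + card V * (3 * k + 4 * 2 ^ k)"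
    if E: "E \<in> ?G" for E
  proof -
    have "card V * card (nonbridges E) \<le>
        card {(x, y, f) \<in> extractions V E. star x f \<subseteq> nonbridges E} + card V * (3 * k + 4 * 2 ^ k)"
      by (intro card_extractions_ge V E) auto
    also have "{(x, y, f) \<in> extractions V E. star x f \<subseteq> nonbridges E} = extractions V E"
      by (auto simp: extractions_def)
    finally show ?thesis .
  qed
  have ins: "card (insertions E) = card (nonbridges E) * card (E - nonbridges E)" if E: "E \<in> ?G" for E
  proof -
    have "{(x, y, f) \<in> insertions E. f \<in> nonbridges E} = insertions E"
      by (auto simp: insertions_def)
    then show ?thesis using card_insertions[OF V(1) E, of "nonbridges E"] by simp
  qed
  have "(\<Sum>E\<in>?G. ?n * ?h E) \<le> (\<Sum>E\<in>?G. real (card (extractions V E)) + ?n * ?B)"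
    using ext by (intro sum_mono) (simp only: of_nat_mult[symmetric] of_nat_add[symmetric] of_nat_le_iff)
  also have "\<dots> = real (\<Sum>E\<in>?G. card (extractions V E)) + (\<Sum>E\<in>?G. ?n * ?B)"
    by (simp add: sum.distrib)
  also have "(\<Sum>E\<in>?G. card (extractions V E)) = (\<Sum>E\<in>?G. card (insertions E))"
    by (rule card_insertions_eq_extractions[OF V(1), symmetric])
  also have "real \<dots> = (\<Sum>E\<in>?G. ?h E * (?n - 1 + k - ?h E))"
    using ins G(5) by (simp only: of_nat_sum of_nat_mult cong: sum.cong)
  finally have "(\<Sum>E\<in>?G. ?n * ?h E) \<le> (\<Sum>E\<in>?G. ?h E * (?n - 1 + k - ?h E) + ?n * ?B)"
    by (simp only: sum.distrib)
  then have "0 \<le> (\<Sum>E\<in>?G. ?h E * (?n - 1 + k - ?h E) + ?n * ?B) - (\<Sum>E\<in>?G. ?n * ?h E)"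
    by (simp only: diff_ge_0_iff_ge)
  also have "\<dots> = (\<Sum>E\<in>?G. (real k - 1) * ?h E + ?n * ?B - ?h E ^ 2)"
    by (simp add: sum_subtractf[symmetric] algebra_simps power2_eq_square)
  finally have "0 \<le> (\<Sum>E\<in>?G. (real k - 1) * ?h E + ?n * ?B) - (\<Sum>E\<in>?G. ?h E ^ 2)"
    by (simp only: sum_subtractf)
  then have "(\<Sum>E\<in>?G. ?h E ^ 2) \<le> (\<Sum>E\<in>?G. (real k - 1) * ?h E + ?n * ?B)" by simp
  also have "\<dots> \<le> (\<Sum>E\<in>?G. ?n * real (k * (k + 1) + 3 * k + 4 * 2 ^ k))"
  proof (rule sum_mono)
    fix E assume E: "E \<in> ?G"
    \<comment> \<open>Origin of \<open>k * (k + 1)\<close>: \<open>h\<close> is at most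
      \<open>n + k\<close>, which is at most \<open>n * (k + 1)\<close> because
      \<open>1 \<le> n\<close>.\<close>
    have "(real k - 1) * ?h E \<le> real k * (?n + k)"
      using G(4)[OF E] by (intro mult_mono) auto
    also have "\<dots> \<le> real k * (?n * (k + 1))"
    proof (rule mult_left_mono)
      have "real k * 1 \<le> real k * ?n" using n1 by (intro mult_left_mono) auto
      then show "?n + k \<le> ?n * (k + 1)" by (simp add: algebra_simps)
    qed simp
    finally show "(real k - 1) * ?h E + ?n * ?B \<le> ?n * real (k * (k + 1) + 3 * k + 4 * 2 ^ k)"
      by (simp add: algebra_simps)
  qed
  also have "\<dots> = ?n * real (k * (k + 1) + 3 * k + 4 * 2 ^ k) * real (card ?G)"
    by (simp only: sum_constant) (simp add: mult.commute mult.left_commute)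
  finally show ?thesis .
qed

text \<open>Pointwise \<open>sqrt n * h \<le> h ^ 2 + n\<close> takes the place of Cauchy-Schwarz;
  the summand \<open>n\<close> adds 1 to the constant.\<close>

lemma sum_card_nonbridges:
  assumes V: "finite V" "V \<noteq> {}"
  shows "(\<Sum>E\<in>conn_graphs V k. real (card (nonbridges E))) \<le>
    sqrt (card V) * real (k * (k + 1) + 3 * k + 4 * 2 ^ k + 1) * real (card (conn_graphs V k))"
proof -
  let ?n = "real (card V)" and ?G = "conn_graphs V k" and ?h = "\<lambda>E. real (card (nonbridges E))"
  let ?C = "real (k * (k + 1) + 3 * k + 4 * 2 ^ k)"
  have n1: "1 \<le> ?n" using V by (simp add: card_gt_0_iff Suc_le_eq)
  then have s: "0 < sqrt ?n" by simp
  have "sqrt ?n * (\<Sum>E\<in>?G. ?h E) = (\<Sum>E\<in>?G. sqrt ?n * ?h E)" by (rule sum_distrib_left)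
  also have "\<dots> \<le> (\<Sum>E\<in>?G. ?h E ^ 2 + ?n)"
  proof (rule sum_mono)
    fix E
    have "0 \<le> (sqrt ?n - ?h E) ^ 2" by simp
    then have "2 * (sqrt ?n * ?h E) \<le> ?h E ^ 2 + ?n" by (simp add: power2_diff)
    moreover have "0 \<le> sqrt ?n * ?h E" by simp
    ultimately show "sqrt ?n * ?h E \<le> ?h E ^ 2 + ?n" by linarith
  qed
  also have "\<dots> = (\<Sum>E\<in>?G. ?h E ^ 2) + ?n * card ?G" by (simp add: sum.distrib mult.commute)
  also have "\<dots> \<le> ?n * ?C * card ?G + ?n * card ?G"
    using sum_card_nonbridges_square[OF V, of k] by linarith
  also have "\<dots> = ?n * ((?C + 1) * card ?G)" by (simp add: algebra_simps)
  also have "\<dots> = sqrt ?n * (sqrt ?n * ((?C + 1) * card ?G))"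
    by (simp only: mult.assoc[symmetric] real_sqrt_mult_self abs_of_nat)
  finally have "(\<Sum>E\<in>?G. ?h E) \<le> sqrt ?n * ((?C + 1) * card ?G)" using s by simp
  then show ?thesis by (simp add: mult.assoc add.commute)
qed

lemma sum_marked:
  fixes g :: "'a set set \<times> 'a set set \<Rightarrow> 'b::comm_monoid_add"
  assumes V: "finite V" and m: "card (all_edges V) < m"
  shows "(\<Sum>l<m. \<Sum>p\<in>marked V k l. g p) = (\<Sum>E\<in>conn_graphs V k. \<Sum>c\<in>even_subs E. g (E, c))"
proof -
  have fS: "finite (even_subs E)" if "E \<in> conn_graphs V k" for E
    using that finite_edges[OF V] by (intro finite_even_subs) (auto simp: conn_graphs_def)
  have le: "card c < m" if "E \<in> conn_graphs V k" "c \<in> even_subs E" for E c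
  proof -
    have "c \<subseteq> all_edges V" using that by (auto simp: conn_graphs_def even_subs_def)
    then have "card c \<le> card (all_edges V)" using finite_all_edges[OF V] by (intro card_mono)
    then show ?thesis using m by simp
  qed
  have "(\<Sum>l<m. \<Sum>p\<in>marked V k l. g p) = (\<Sum>p\<in>(\<Union>l<m. marked V k l). g p)"
    using finite_marked[OF V] by (intro sum.UNION_disjoint[symmetric]) (auto simp: marked_def)
  also have "(\<Union>l<m. marked V k l) = Sigma (conn_graphs V k) even_subs"
    using le by (auto simp: marked_def)
  also have "(\<Sum>p\<in>Sigma (conn_graphs V k) even_subs. g p) =
      (\<Sum>E\<in>conn_graphs V k. \<Sum>c\<in>even_subs E. g (E, c))"
    using finite_conn_graphs[OF V] fS by (subst sum.Sigma) auto
  finally show ?thesis .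
qed

lemma sum_marked_le:
  fixes g :: "'a set set \<times> 'a set set \<Rightarrow> real"
  assumes V: "finite V" and g: "\<And>p. 0 \<le> g p"
  shows "(\<Sum>l<m. \<Sum>p\<in>marked V k l. g p) \<le> (\<Sum>E\<in>conn_graphs V k. \<Sum>c\<in>even_subs E. g (E, c))"
proof -
  let ?m = "max m (Suc (card (all_edges V)))"
  have "(\<Sum>l<m. \<Sum>p\<in>marked V k l. g p) \<le> (\<Sum>l<?m. \<Sum>p\<in>marked V k l. g p)"
    using g by (intro sum_mono2 sum_nonneg) auto
  also have "\<dots> = (\<Sum>E\<in>conn_graphs V k. \<Sum>c\<in>even_subs E. g (E, c))"
    by (intro sum_marked V) auto
  finally show ?thesis .
qed

text \<open>Both parts compare the moves between levels \<open>l\<close> and \<open>Suc l\<close>: a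
  pair below has exactly \<open>l\<close> times the number of bridges, a pair above between
  \<open>n * (Suc l - B)\<close> and \<open>n * Suc l\<close>, where
  \<open>B = 3 * k + 4 * 2 ^ k\<close>.\<close>

lemma marked_recursion:
  fixes V :: "'a set" and k l :: nat and a h :: "nat \<Rightarrow> real"
  assumes V: "finite V" "V \<noteq> {}"
  defines "a \<equiv> \<lambda>l. real (card (marked V k l))"
  defines "h \<equiv> \<lambda>l. \<Sum>(E, c)\<in>marked V k l. real (card (nonbridges E) + k + 1)"
  shows "l * (card V * a l - h l) \<le> card V * (Suc l * a (Suc l))"
    and "card V * (Suc l * a (Suc l)) \<le>
      l * (card V * a l + h l) + card V * (real (3 * k + 4 * 2 ^ k) * a (Suc l))"
proof -
  let ?n = "real (card V)"
  let ?B = "3 * k + 4 * 2 ^ k"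
  define e where "e = (\<lambda>(E, c). card {(x, y, f) \<in> extractions V E. star x f \<subseteq> c})"
  have mem: "E \<in> conn_graphs V k" "E \<subseteq> all_edges V" "c \<in> even_subs E" "card c = l" "c \<subseteq> nonbridges E"
    if "(E, c) \<in> marked V k l" for E c l
    using that even_sub_nonbridges[OF V(1), of E c] by (auto simp: marked_def conn_graphs_def)
  have "(\<Sum>p\<in>marked V k (Suc l). real (e p)) = (\<Sum>(E, c)\<in>marked V k l. real (l * card (E - nonbridges E)))"
  proof -
    have "(\<Sum>p\<in>marked V k (Suc l). e p) =
        (\<Sum>(E, c)\<in>marked V k l. card {(x, y, f) \<in> insertions E. f \<in> c})"
      unfolding card_marked_moves[OF V(1)] e_def by (simp add: case_prod_unfold)
    also have "\<dots> = (\<Sum>(E, c)\<in>marked V k l. l * card (E - nonbridges E))"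
    proof (rule sum.cong[OF refl], clarify)
      fix E c assume p: "(E, c) \<in> marked V k l"
      show "card {(x, y, f) \<in> insertions E. f \<in> c} = l * card (E - nonbridges E)"
        using card_insertions[OF V(1) mem(1)[OF p] mem(5)[OF p]] mem(4)[OF p] by simp
    qed
    finally have "real (\<Sum>p\<in>marked V k (Suc l). e p) =
        real (\<Sum>(E, c)\<in>marked V k l. l * card (E - nonbridges E))" by simp
    then show ?thesis by (simp add: case_prod_unfold)
  qed
  also have "\<dots> = (\<Sum>(E, c)\<in>marked V k l. l * (?n + (real k - 1 - card (nonbridges E))))"
  proof (rule sum.cong[OF refl], clarify)
    fix E c assume p: "(E, c) \<in> marked V k l"
    have fE: "finite E" using finite_edges[OF V(1) mem(2)[OF p]] .
    have "card E + 1 = card V + k" using mem(1)[OF p] by (auto simp: conn_graphs_def)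
    moreover have "card (nonbridges E) \<le> card E" using fE nonbridges_subset by (rule card_mono)
    moreover have "card (E - nonbridges E) = card E - card (nonbridges E)"
      using fE nonbridges_subset by (intro card_Diff_subset) (auto intro: finite_subset)
    ultimately have "real (card (E - nonbridges E)) = ?n + (real k - 1 - card (nonbridges E))" by linarith
    then show "real (l * card (E - nonbridges E)) = l * (?n + (real k - 1 - card (nonbridges E)))" by simp
  qed
  finally have sum_e: "(\<Sum>p\<in>marked V k (Suc l). real (e p)) = \<dots>" .
  have "\<dots> = l * (\<Sum>(E, c)\<in>marked V k l. ?n + (real k - 1 - card (nonbridges E)))"
    by (simp add: sum_distrib_left case_prod_unfold)
  also have "(\<Sum>(E, c)\<in>marked V k l. ?n + (real k - 1 - card (nonbridges E))) =
      ?n * a l + (\<Sum>(E, c)\<in>marked V k l. real k - 1 - card (nonbridges E))"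
    by (simp add: sum.distrib case_prod_unfold a_def mult.commute)
  finally have *: "(\<Sum>p\<in>marked V k (Suc l). real (e p)) =
      l * (?n * a l + (\<Sum>(E, c)\<in>marked V k l. real k - 1 - card (nonbridges E)))"
    using sum_e by simp
  \<comment> \<open>The deviation \<open>k - 1 - card (nonbridges E)\<close> of the bridge count
    from \<open>n\<close> is at most the weight in \<open>h\<close> in absolute value, so one
    \<open>h\<close> serves both directions.\<close>
  have "- h l \<le> (\<Sum>(E, c)\<in>marked V k l. real k - 1 - card (nonbridges E))"
    unfolding h_def sum_negf[symmetric] by (intro sum_mono) auto
  then have lower: "l * (?n * a l - h l) \<le> (\<Sum>p\<in>marked V k (Suc l). real (e p))"
    unfolding * by (intro mult_left_mono) auto
  have "(\<Sum>(E, c)\<in>marked V k l. real k - 1 - card (nonbridges E)) \<le> h l"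
    unfolding h_def by (intro sum_mono) auto
  then have upper: "(\<Sum>p\<in>marked V k (Suc l). real (e p)) \<le> l * (?n * a l + h l)"
    unfolding * by (intro mult_left_mono) auto
  have e_le: "e p \<le> card V * Suc l" and e_ge: "card V * Suc l \<le> e p + card V * ?B"
    if p': "p \<in> marked V k (Suc l)" for p
  proof -
    obtain E c where pc: "p = (E, c)" by (cases p)
    have p: "(E, c) \<in> marked V k (Suc l)" using p' pc by simp
    note m = mem[OF p]
    have "c \<subseteq> E" using m(3) by (auto simp: even_subs_def)
    then show "e p \<le> card V * Suc l"
      using card_extractions_le[OF V(1) m(1), of c] m(4) by (simp add: e_def pc)
    have "finite (nonbridges E)"
      using finite_edges[OF V(1) m(2)] nonbridges_subset[of E] by (meson finite_subset)
    then have "deg c v = 0 \<or> deg c v = 2" if "deg (nonbridges E) v = 2" for v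
    proof -
      have "deg c v \<le> 2" using deg_mono[OF \<open>finite (nonbridges E)\<close> m(5), of v] that by simp
      moreover have "even (deg c v)" using m(3) by (auto simp: even_subs_def)
      ultimately show ?thesis by presburger
    qed
    then show "card V * Suc l \<le> e p + card V * ?B"
      using card_extractions_ge[OF V m(1) m(5)] m(4) by (simp add: e_def pc)
  qed
  have "(\<Sum>p\<in>marked V k (Suc l). real (e p)) \<le> (\<Sum>p\<in>marked V k (Suc l). real (card V * Suc l))"
    using e_le by (intro sum_mono) (simp only: of_nat_le_iff)
  also have "\<dots> = ?n * (Suc l * a (Suc l))"
    by (simp only: sum_constant a_def of_nat_mult mult_ac)
  finally show "l * (?n * a l - h l) \<le> ?n * (Suc l * a (Suc l))" using lower by linarith
  have "?n * (Suc l * a (Suc l)) = (\<Sum>p\<in>marked V k (Suc l). real (card V * Suc l))"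
    by (simp only: sum_constant a_def of_nat_mult mult_ac)
  also have "\<dots> \<le> (\<Sum>p\<in>marked V k (Suc l). real (e p + card V * ?B))"
    using e_ge by (intro sum_mono) (simp only: of_nat_le_iff)
  also have "\<dots> = (\<Sum>p\<in>marked V k (Suc l). real (e p)) + ?n * (real ?B * a (Suc l))"
    by (simp only: of_nat_add sum.distrib sum_constant a_def of_nat_mult mult_ac)
  finally show "?n * (Suc l * a (Suc l)) \<le> l * (?n * a l + h l) + ?n * (real ?B * a (Suc l))"
    using upper by linarith
qed

section \<open>Alternating sums of slowly varying sequences\<close>

lemma sum_inverse_ge_ln:
  assumes "1 \<le> l"
  shows "ln (real (l + J)) - ln (real l) \<le> (\<Sum>j<J. 1 / real (l + j))"
proof (induction J)
  case 0
  then show ?case by simp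
next
  case (Suc J)
  have pos: "0 < real (l + J)" using assms by simp
  have "ln (real (l + Suc J)) - ln (real (l + J)) = ln (1 + 1 / real (l + J))"
  proof -
    have "1 + 1 / real (l + J) = real (l + Suc J) / real (l + J)" using pos by (simp add: field_simps)
    then show ?thesis using pos by (simp add: ln_div)
  qed
  also have "\<dots> \<le> 1 / real (l + J)" using pos by (intro ln_add_one_self_le_self) simp
  finally show ?case using Suc by simp
qed

text \<open>The recursion makes \<open>l * a l\<close> almost nondecreasing, so a term of size \<open>\<delta>\<close> would force a
  divergent harmonic-type sum.\<close>

lemma recursion_term_le:
  fixes a \<mu> :: "nat \<Rightarrow> real"
  assumes nonneg: "\<And>l. 0 \<le> a l" "\<And>l. 0 \<le> \<mu> l"
    and sum_a: "\<And>m. (\<Sum>l<m. a l) \<le> K" and sum_\<mu>: "\<And>m. (\<Sum>l<m. \<mu> l) \<le> \<epsilon>"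
    and lower: "\<And>l. l * (a l - \<mu> l) \<le> Suc l * a (Suc l)"
    and l: "1 \<le> l"
  shows "a l * (ln (real (l + J)) - ln (real l)) \<le> K + J * \<epsilon>"
proof -
  have \<epsilon>: "0 \<le> \<epsilon>" using sum_\<mu>[of 0] by simp
  \<comment> \<open>Iterating \<open>lower\<close> charges each \<open>\<mu> (l + i)\<close> with
    weight \<open>l + i\<close>, which is enlarged to \<open>l + j\<close>.\<close>
  have grow: "l * a l - (l + j) * (\<Sum>i<j. \<mu> (l + i)) \<le> (l + j) * a (l + j)" for j
  proof (induction j)
    case 0
    then show ?case by simp
  next
    case (Suc j)
    have "l * a l - (l + Suc j) * (\<Sum>i<Suc j. \<mu> (l + i)) \<le>
        l * a l - (l + j) * (\<Sum>i<Suc j. \<mu> (l + i))"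
      using nonneg by (intro diff_left_mono mult_right_mono sum_nonneg) auto
    also have "\<dots> = l * a l - (l + j) * (\<Sum>i<j. \<mu> (l + i)) - (l + j) * \<mu> (l + j)"
      by (simp add: algebra_simps)
    also have "\<dots> \<le> (l + j) * (a (l + j) - \<mu> (l + j))"
      using Suc by (simp add: right_diff_distrib)
    also have "\<dots> \<le> (l + Suc j) * a (l + Suc j)" using lower[of "l + j"] by simp
    finally show ?case .
  qed
  \<comment> \<open>All later terms are at least of harmonic size \<open>a l / (l + j)\<close>, up
    to \<open>\<epsilon>\<close>; their sum is still at most \<open>K\<close>.\<close>
  have term_le: "a l * (1 / real (l + j)) \<le> a (l + j) + \<epsilon>" for j
  proof -
    have "(\<Sum>i<j. \<mu> (l + i)) = (\<Sum>i\<in>{l..<l+j}. \<mu> i)"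
      by (rule sum.reindex_bij_witness[where i = "\<lambda>i. i - l" and j = "\<lambda>i. l + i"]) auto
    also have "\<dots> \<le> (\<Sum>i<l+j. \<mu> i)" using nonneg by (intro sum_mono2) auto
    also have "\<dots> \<le> \<epsilon>" by (rule sum_\<mu>)
    finally have "(l + j) * (\<Sum>i<j. \<mu> (l + i)) \<le> (l + j) * \<epsilon>" by (intro mult_left_mono) auto
    then have "l * a l \<le> (l + j) * (a (l + j) + \<epsilon>)" using grow[of j] by (simp add: distrib_left)
    moreover have "1 * a l \<le> l * a l" using nonneg l by (intro mult_right_mono) auto
    ultimately show ?thesis using l by (simp add: field_simps)
  qed
  have "a l * (ln (real (l + J)) - ln (real l)) \<le> a l * (\<Sum>j<J. 1 / real (l + j))"
    using sum_inverse_ge_ln[OF l] nonneg by (intro mult_left_mono)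
  also have "\<dots> \<le> (\<Sum>j<J. a (l + j) + \<epsilon>)"
    unfolding sum_distrib_left using term_le by (intro sum_mono)
  also have "\<dots> = (\<Sum>j<J. a (l + j)) + J * \<epsilon>" by (simp add: sum.distrib)
  also have "(\<Sum>j<J. a (l + j)) = (\<Sum>i\<in>{l..<l+J}. a i)"
    by (rule sum.reindex_bij_witness[where i = "\<lambda>i. i - l" and j = "\<lambda>i. l + i"]) auto
  also have "\<dots> \<le> (\<Sum>i<l+J. a i)" using nonneg by (intro sum_mono2) auto
  also have "\<dots> \<le> K" by (rule sum_a)
  finally show ?thesis by simp
qed

text \<open>Summation by parts: twice the alternating sum is the boundary terms plus an alternating
  sum of differences, and the recursion bounds a difference by
  \<open>(B + 1) * a (Suc l) / L + \<mu> l\<close>. The end at \<open>D\<close> contributes nothing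
  since \<open>a D = 0\<close>.\<close>

lemma alternating_tail_le:
  fixes a \<mu> :: "nat \<Rightarrow> real"
  assumes nonneg: "\<And>l. 0 \<le> a l" "\<And>l. 0 \<le> \<mu> l" "0 \<le> B"
    and sum_a: "\<And>m. (\<Sum>l<m. a l) \<le> K" and sum_\<mu>: "\<And>m. (\<Sum>l<m. \<mu> l) \<le> \<epsilon>"
    and lower: "\<And>l. l * (a l - \<mu> l) \<le> Suc l * a (Suc l)"
    and upper: "\<And>l. Suc l * a (Suc l) \<le> l * (a l + \<mu> l) + B * a (Suc l)"
    and L: "1 \<le> L" and D: "L \<le> D" "a D = 0"
  shows "\<bar>\<Sum>l=L..<D. (-1) ^ l * a l\<bar> \<le> a L + (B + 1) * K / L + \<epsilon>"
proof -
  have tele: "2 * (\<Sum>l=L..<D. (-1) ^ l * a l) =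
      (-1) ^ L * a L - (-1) ^ D * a D + (\<Sum>l=L..<D. (-1) ^ l * (a l - a (Suc l)))"
    using D(1) by (induction D rule: dec_induct) (simp_all add: algebra_simps)
  have diff: "\<bar>a l - a (Suc l)\<bar> \<le> (B + 1) * a (Suc l) / L + \<mu> l" if l: "L \<le> l" for l
  proof -
    have lpos: "0 < real l" using L l by simp
    have "real l * (a l - a (Suc l)) \<le> a (Suc l) + l * \<mu> l"
      using lower[of l] by (simp add: algebra_simps)
    also have "\<dots> \<le> (B + 1) * a (Suc l) + l * \<mu> l"
      using nonneg by (simp add: distrib_right)
    finally have 1: "real l * (a l - a (Suc l)) \<le> (B + 1) * a (Suc l) + l * \<mu> l" .
    have "real l * (a (Suc l) - a l) \<le> (B - 1) * a (Suc l) + l * \<mu> l"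
      using upper[of l] by (simp add: algebra_simps)
    also have "\<dots> \<le> (B + 1) * a (Suc l) + l * \<mu> l"
      using nonneg by (intro add_right_mono mult_right_mono) auto
    finally have "real l * (a (Suc l) - a l) \<le> (B + 1) * a (Suc l) + l * \<mu> l" .
    then have "a (Suc l) - a l \<le> (B + 1) * a (Suc l) / l + \<mu> l"
      using lpos by (simp add: field_simps)
    moreover have "a l - a (Suc l) \<le> (B + 1) * a (Suc l) / l + \<mu> l"
      using 1 lpos by (simp add: field_simps)
    ultimately have "\<bar>a l - a (Suc l)\<bar> \<le> (B + 1) * a (Suc l) / l + \<mu> l" by linarith
    also have "(B + 1) * a (Suc l) / l \<le> (B + 1) * a (Suc l) / L"
      using nonneg L l by (intro divide_left_mono) auto
    finally show ?thesis by simp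
  qed
  have "\<bar>\<Sum>l=L..<D. (-1) ^ l * (a l - a (Suc l))\<bar> \<le> (\<Sum>l=L..<D. \<bar>(-1) ^ l * (a l - a (Suc l))\<bar>)"
    by (rule sum_abs)
  also have "\<dots> \<le> (\<Sum>l=L..<D. (B + 1) * a (Suc l) / L + \<mu> l)"
    using diff by (intro sum_mono) (simp add: abs_mult)
  also have "\<dots> = (B + 1) * (\<Sum>l=L..<D. a (Suc l)) / L + (\<Sum>l=L..<D. \<mu> l)"
    by (simp add: sum.distrib sum_distrib_left sum_divide_distrib)
  also have "\<dots> \<le> (B + 1) * K / L + \<epsilon>"
  proof (intro add_mono divide_right_mono mult_left_mono)
    have "(\<Sum>l=L..<D. a (Suc l)) = (\<Sum>l=Suc L..<Suc D. a l)" by (rule sum.shift_bounds_Suc_ivl[symmetric])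
    also have "\<dots> \<le> (\<Sum>l<Suc D. a l)" using nonneg by (intro sum_mono2) auto
    also have "\<dots> \<le> K" by (rule sum_a)
    finally show "(\<Sum>l=L..<D. a (Suc l)) \<le> K" .
    have "(\<Sum>l=L..<D. \<mu> l) \<le> (\<Sum>l<D. \<mu> l)" using nonneg by (intro sum_mono2) auto
    also have "\<dots> \<le> \<epsilon>" by (rule sum_\<mu>)
    finally show "(\<Sum>l=L..<D. \<mu> l) \<le> \<epsilon>" .
  qed (use nonneg in auto)
  finally have "\<bar>\<Sum>l=L..<D. (-1) ^ l * (a l - a (Suc l))\<bar> \<le> (B + 1) * K / L + \<epsilon>" .
  moreover have "\<bar>(-1) ^ L * a L\<bar> = a L" using nonneg by (simp add: abs_mult)
  ultimately have "2 * \<bar>\<Sum>l=L..<D. (-1) ^ l * a l\<bar> \<le> a L + (B + 1) * K / L + \<epsilon>"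
    using tele D(2) by simp
  then show ?thesis by linarith
qed

text \<open>The sum starts at 1 because term 0 is the main term, and at \<open>l = 0\<close> the
  factor \<open>l\<close> removes \<open>a n 0\<close> from the recursion.\<close>

lemma alternating_sum_tendsto_0:
  fixes a \<mu> :: "nat \<Rightarrow> nat \<Rightarrow> real" and K B :: real and \<epsilon> :: "nat \<Rightarrow> real" and D :: "nat \<Rightarrow> nat"
  assumes nonneg: "\<And>n l. 0 \<le> a n l" "\<And>n l. 0 \<le> \<mu> n l" "0 \<le> B"
    and sum_a: "\<And>n m. M \<le> n \<Longrightarrow> (\<Sum>l<m. a n l) \<le> K"
    and sum_\<mu>: "\<And>n m. M \<le> n \<Longrightarrow> (\<Sum>l<m. \<mu> n l) \<le> \<epsilon> n"
    and lower: "\<And>n l. M \<le> n \<Longrightarrow> l * (a n l - \<mu> n l) \<le> Suc l * a n (Suc l)"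
    and upper: "\<And>n l. M \<le> n \<Longrightarrow> Suc l * a n (Suc l) \<le> l * (a n l + \<mu> n l) + B * a n (Suc l)"
    and D: "\<And>n l. M \<le> n \<Longrightarrow> D n \<le> l \<Longrightarrow> a n l = 0"
    and \<epsilon>: "\<epsilon> \<longlonglongrightarrow> 0"
  shows "(\<lambda>n. \<Sum>l=1..<D n. (-1) ^ l * a n l) \<longlonglongrightarrow> 0"
proof -
  have K: "0 \<le> K" using sum_a[of M 0] by simp
  \<comment> \<open>\<open>J\<close> is chosen first, so that the logarithm exceeds
    \<open>(K + 1) / r\<close>, and only then \<open>n\<close>, so that
    \<open>J * \<epsilon> n < 1\<close>.\<close>
  have fixed: "(\<lambda>n. a n l) \<longlonglongrightarrow> 0" if l: "1 \<le> l" for l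
  proof (rule LIMSEQ_I)
    fix r :: real assume r: "0 < r"
    have "filterlim (\<lambda>J. ln (real (l + J))) at_top sequentially"
      by (intro filterlim_compose[OF ln_at_top] filterlim_compose[OF filterlim_real_sequentially]
          filterlim_subseq) (auto simp: strict_mono_def)
    then have "eventually (\<lambda>J. ln (real l) + (K + 1) / r + 1 \<le> ln (real (l + J))) sequentially"
      by (rule filterlim_at_top[THEN iffD1, rule_format])
    then obtain J where J: "ln (real l) + (K + 1) / r + 1 \<le> ln (real (l + J))"
      by (auto simp: eventually_sequentially)
    define h where "h = ln (real (l + J)) - ln (real l)"
    have h: "(K + 1) / r < h" using J by (simp add: h_def)
    have "(\<lambda>n. J * \<epsilon> n) \<longlonglongrightarrow> real J * 0" by (intro tendsto_intros \<epsilon>)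
    then have "eventually (\<lambda>n. J * \<epsilon> n < 1) sequentially" by (rule order_tendstoD) simp
    then obtain n1 where n1: "\<And>n. n1 \<le> n \<Longrightarrow> J * \<epsilon> n < 1" by (auto simp: eventually_sequentially)
    have hpos: "0 < h" using h K r by (smt (verit) divide_nonneg_pos)
    have "a n l < r" if n: "max M n1 \<le> n" for n
    proof -
      have "a n l * h \<le> K + J * \<epsilon> n"
        unfolding h_def using n l nonneg sum_a sum_\<mu> lower
        by (intro recursion_term_le[where \<mu> = "\<mu> n"]) auto
      also have "\<dots> < K + 1" using n1[of n] n by simp
      also have "\<dots> < r * h" using h r by (simp add: field_simps)
      finally show ?thesis using hpos by simp
    qed
    then show "\<exists>no. \<forall>n\<ge>no. norm (a n l - 0) < r"
      using nonneg by (intro exI[of _ "max M n1"]) auto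
  qed
  show ?thesis
  proof (rule LIMSEQ_I)
    fix r :: real assume r: "0 < r"
    \<comment> \<open>\<open>L\<close> depends on \<open>r\<close> alone and makes the drift small
      for all \<open>n\<close>; the finitely many terms up to \<open>L\<close> are left to
      \<open>fixed\<close>.\<close>
    obtain L0 :: nat where L0: "(B + 1) * K / (r / 4) < L0" using reals_Archimedean2 by blast
    define L where "L = max 1 L0"
    have L: "1 \<le> L" "(B + 1) * K / L < r / 4"
    proof -
      show "1 \<le> L" by (simp add: L_def)
      have "(B + 1) * K / (r / 4) < L" using L0 by (simp add: L_def)
      then show "(B + 1) * K / L < r / 4" using r \<open>1 \<le> L\<close> by (simp add: field_simps)
    qed
    have "(\<lambda>n. \<Sum>l=1..<L. a n l) \<longlonglongrightarrow> (\<Sum>l=1..<L. 0)"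
      by (intro tendsto_sum fixed) auto
    then have "(\<lambda>n. (\<Sum>l=1..<L. a n l) + a n L + \<epsilon> n) \<longlonglongrightarrow> 0 + 0 + 0"
      by (intro tendsto_add \<epsilon> fixed L(1)) simp_all
    then have "eventually (\<lambda>n. (\<Sum>l=1..<L. a n l) + a n L + \<epsilon> n < r / 2) sequentially"
      by (rule order_tendstoD) (use r in simp)
    then obtain n1 where n1: "\<And>n. n1 \<le> n \<Longrightarrow> (\<Sum>l=1..<L. a n l) + a n L + \<epsilon> n < r / 2"
      by (auto simp: eventually_sequentially)
    have "\<bar>\<Sum>l=1..<D n. (-1) ^ l * a n l\<bar> < r" if n: "max M n1 \<le> n" for n
    proof -
      have nM: "M \<le> n" using n by simp
      \<comment> \<open>The tail estimate needs an end not below \<open>L\<close>; the terms added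
        are zero.\<close>
      define E where "E = max L (D n)"
      have "(\<Sum>l=1..<D n. (-1) ^ l * a n l) = (\<Sum>l=1..<E. (-1) ^ l * a n l)"
        using D[OF nM] by (intro sum.mono_neutral_left) (auto simp: E_def)
      also have "\<dots> = (\<Sum>l=1..<L. (-1) ^ l * a n l) + (\<Sum>l=L..<E. (-1) ^ l * a n l)"
        using L by (intro sum.atLeastLessThan_concat[symmetric]) (auto simp: E_def)
      finally have "\<bar>\<Sum>l=1..<D n. (-1) ^ l * a n l\<bar> \<le>
          \<bar>\<Sum>l=1..<L. (-1) ^ l * a n l\<bar> + \<bar>\<Sum>l=L..<E. (-1) ^ l * a n l\<bar>" by simp
      also have "\<bar>\<Sum>l=1..<L. (-1) ^ l * a n l\<bar> \<le> (\<Sum>l=1..<L. \<bar>(-1) ^ l * a n l\<bar>)" by (rule sum_abs)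
      also have "\<dots> = (\<Sum>l=1..<L. a n l)" using nonneg by (simp add: abs_mult)
      also have "\<bar>\<Sum>l=L..<E. (-1) ^ l * a n l\<bar> \<le> a n L + (B + 1) * K / L + \<epsilon> n"
        using nM nonneg sum_a sum_\<mu> lower upper L(1) D[OF nM]
        by (intro alternating_tail_le[where \<mu> = "\<mu> n"]) (auto simp: E_def)
      finally have "\<bar>\<Sum>l=1..<D n. (-1) ^ l * a n l\<bar> \<le>
          (\<Sum>l=1..<L. a n l) + (a n L + (B + 1) * K / L + \<epsilon> n)" by simp
      moreover have "(\<Sum>l=1..<L. a n l) + a n L + \<epsilon> n < r / 2" using n1[of n] n by simp
      ultimately show ?thesis using L(2) r by linarith
    qed
    then show "\<exists>no. \<forall>n\<ge>no. norm ((\<Sum>l=1..<D n. (-1) ^ l * a n l) - 0) < r"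
      by (intro exI[of _ "max M n1"]) auto
  qed
qed

section \<open>Translation to edge sets\<close>

definition bip_graphs :: "'a set \<Rightarrow> 'a set \<Rightarrow> nat \<Rightarrow> 'a set set set" where
  "bip_graphs V S k = {E \<in> conn_graphs V k. \<forall>e\<in>E. card (S \<inter> e) = 1}"

lemma mem_undirected_edges:
  assumes "pair_graph G"
  shows "{u, v} \<in> undirected_edges G \<longleftrightarrow> (u, v) \<in> parcs G"
proof -
  interpret pair_graph G by fact
  have "(v, u) \<in> parcs G" if "(u, v) \<in> parcs G" for u v
    using that arcs_symmetric by auto
  then show ?thesis unfolding undirected_edges_def by (auto simp: doubleton_eq_iff image_iff)
qed

lemma undirected_edges_subset:
  assumes "pair_graph G"
  shows "undirected_edges G \<subseteq> all_edges (pverts G)"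
proof -
  interpret pair_graph G by fact
  show ?thesis
    unfolding undirected_edges_def all_edges_def
    using in_arcsD1 in_arcsD2 pair_no_loops by (fastforce simp: card_2_iff)
qed

text \<open>An uncut set is preserved along walks, and conversely the set reachable from
  \<open>u\<close> is uncut. \<open>V\<close> is nonempty because the digraph notion of
  connectedness demands a vertex.\<close>

lemma connected_iff_uncut:
  assumes "pair_graph G" and V: "pverts G = V" "V \<noteq> {}"
  shows "Digraph_Component.connected (with_proj G) \<longleftrightarrow>
    (\<forall>S\<subseteq>V. uncut S (undirected_edges G) \<longrightarrow> S = {} \<or> S = V)"
proof -
  let ?U = "undirected_edges G"
  have arcs: "(u, v) \<in> parcs (mk_symmetric (with_proj G)) \<longleftrightarrow> {u, v} \<in> ?U" for u v
  proof -
    have "(u, v) \<in> parcs (mk_symmetric (with_proj G)) \<longleftrightarrow> (u, v) \<in> parcs G \<or> (v, u) \<in> parcs G"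
      unfolding parcs_mk_symmetric by simp (metis fst_conv prod.collapse snd_conv)
    then show ?thesis
      using mem_undirected_edges[OF assms(1), of u v] mem_undirected_edges[OF assms(1), of v u]
      by (simp add: insert_commute)
  qed
  have UV: "?U \<subseteq> all_edges V" using undirected_edges_subset[OF assms(1)] V by simp
  let ?r = "{(u, v). {u, v} \<in> ?U}"
  have "Digraph_Component.connected (with_proj G) \<longleftrightarrow> (\<forall>u\<in>V. \<forall>v\<in>V. (u, v) \<in> rtrancl_on V ?r)"
  proof -
    have "parcs (mk_symmetric (with_proj G)) = ?r" using arcs by auto
    then show ?thesis
      using V by (simp add: Digraph_Component.connected_def strongly_connected_def reachable_def)
  qed
  also have "\<dots> \<longleftrightarrow> (\<forall>S\<subseteq>V. uncut S ?U \<longrightarrow> S = {} \<or> S = V)"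
  proof (intro iffI allI impI ballI)
    fix S assume conn: "\<forall>u\<in>V. \<forall>v\<in>V. (u, v) \<in> rtrancl_on V ?r" and S: "S \<subseteq> V" "uncut S ?U"
    have "v \<in> S" if u: "u \<in> S" and v: "v \<in> V" for u v
    proof -
      have "(u, v) \<in> rtrancl_on V ?r" using conn u v S by blast
      then show ?thesis
      proof (induction rule: rtrancl_on_induct)
        case base
        then show ?case using u by simp
      next
        case (step y z)
        then show ?case using uncutD[OF S(2), of y z] by simp
      qed
    qed
    then show "S = {} \<or> S = V" using S by blast
  next
    fix u v assume conn: "\<forall>S\<subseteq>V. uncut S ?U \<longrightarrow> S = {} \<or> S = V" and uv: "u \<in> V" "v \<in> V"
    define S where "S = {w. (u, w) \<in> rtrancl_on V ?r}"
    have SV: "S \<subseteq> V" using in_rtrancl_on_in_F by (fastforce simp: S_def)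
    have step: "b \<in> S" if "a \<in> S" "{a, b} \<in> ?U" for a b
    proof -
      have "b \<in> V" using that(2) UV by (auto simp: all_edges_def)
      then show ?thesis
        using that rtrancl_on_into_rtrancl_on[of u a V ?r b] by (simp add: S_def)
    qed
    have "e \<subseteq> S \<or> e \<inter> S = {}" if e: "e \<in> ?U" for e
    proof -
      have "e \<in> all_edges V" using e UV by auto
      then obtain a b where ab: "e = {a, b}" by (elim all_edgesE)
      then have "a \<in> S \<longleftrightarrow> b \<in> S" using step[of a b] step[of b a] e by (auto simp: insert_commute)
      then show ?thesis using ab by auto
    qed
    then have "uncut S ?U" by (auto simp: uncut_def)
    moreover have "u \<in> S" using uv by (simp add: S_def)
    ultimately have "S = V" using conn SV by blast
    then show "(u, v) \<in> rtrancl_on V ?r" using uv by (auto simp: S_def)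
  qed
  finally show ?thesis .
qed

definition graph_of :: "'a set \<Rightarrow> 'a set set \<Rightarrow> 'a pair_pre_digraph" where
  "graph_of V E = \<lparr>pverts = V, parcs = {(u, v). {u, v} \<in> E}\<rparr>"

lemma pair_graph_graph_of:
  assumes V: "finite V" and E: "E \<subseteq> all_edges V"
  shows "pair_graph (graph_of V E)" "pverts (graph_of V E) = V" "undirected_edges (graph_of V E) = E"
proof -
  have *: "u \<in> V \<and> v \<in> V \<and> u \<noteq> v" if "{u, v} \<in> E" for u v
    using that E by (auto simp: all_edges_def)
  have "parcs (graph_of V E) \<subseteq> V \<times> V" using * by (auto simp: graph_of_def)
  then have fin: "finite (parcs (graph_of V E))" using V finite_subset by blast
  have sym: "sym (parcs (graph_of V E))" by (auto simp: graph_of_def sym_def insert_commute)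
  show "pair_graph (graph_of V E)"
    by unfold_locales (use * fin sym V in \<open>auto simp: graph_of_def symmetric_def\<close>)
  show "pverts (graph_of V E) = V" by (simp add: graph_of_def)
  have "e \<in> undirected_edges (graph_of V E)" if "e \<in> E" for e
  proof -
    have "e \<in> all_edges V" using that E by auto
    then obtain a b where "e = {a, b}" by (elim all_edgesE)
    then show ?thesis using that by (auto simp: undirected_edges_def graph_of_def)
  qed
  then show "undirected_edges (graph_of V E) = E"
    by (auto simp: undirected_edges_def graph_of_def)
qed

lemma graph_of_undirected_edges:
  assumes "pair_graph G"
  shows "graph_of (pverts G) (undirected_edges G) = G"
  using mem_undirected_edges[OF assms] by (cases G) (auto simp: graph_of_def)

text \<open>The predicate \<open>P\<close> lets one bijection serve both counts: trivial for
  \<open>N\<close>, the colouring condition for \<open>N_bi\<close>.\<close>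

lemma card_pair_graphs:
  assumes V: "finite V" "V \<noteq> {}"
  shows "card {G. pair_graph G \<and> pverts G = V \<and> Digraph_Component.connected (with_proj G) \<and>
      card (undirected_edges G) + 1 = card V + k \<and> P (undirected_edges G)} =
    card {E \<in> conn_graphs V k. P E}"
    (is "card ?A = card ?B")
proof (rule bij_betw_same_card)
  show "bij_betw undirected_edges ?A ?B"
  proof (rule bij_betw_byWitness[where f' = "graph_of V"])
    show "\<forall>E\<in>?B. undirected_edges (graph_of V E) = E"
      using pair_graph_graph_of(3)[OF V(1)] by (auto simp: conn_graphs_def)
    show "undirected_edges ` ?A \<subseteq> ?B"
    proof (rule image_subsetI)
      fix G assume "G \<in> ?A"
      then have G: "pair_graph G" "pverts G = V" "Digraph_Component.connected (with_proj G)"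
        "card (undirected_edges G) + 1 = card V + k" "P (undirected_edges G)" by auto
      have "undirected_edges G \<subseteq> all_edges V" using undirected_edges_subset[OF G(1)] G(2) by simp
      moreover have "\<forall>S\<subseteq>V. uncut S (undirected_edges G) \<longrightarrow> S = {} \<or> S = V"
        using connected_iff_uncut[OF G(1,2) V(2)] G(3) by blast
      ultimately show "undirected_edges G \<in> ?B" using G(4,5) by (simp add: conn_graphs_def)
    qed
    show "graph_of V ` ?B \<subseteq> ?A"
    proof (rule image_subsetI)
      fix E assume E: "E \<in> ?B"
      then have EV: "E \<subseteq> all_edges V" by (simp add: conn_graphs_def)
      note g = pair_graph_graph_of[OF V(1) EV]
      show "graph_of V E \<in> ?A"
        unfolding mem_Collect_eq connected_iff_uncut[OF g(1,2) V(2)] g(2,3)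
        using E g(1) by (simp add: conn_graphs_def)
    qed
  qed (use graph_of_undirected_edges in auto)
qed

lemma N_eq: "1 \<le> n \<Longrightarrow> N n k = card (conn_graphs {1..n} k)"
  using card_pair_graphs[of "{1..n}" k "\<lambda>_. True"] by (simp add: N_def)

lemma bipartite_with_iff:
  assumes "V1 \<inter> V2 = {}"
  shows "pair_graph G \<and> bipartite_with V1 V2 G \<longleftrightarrow>
    pair_graph G \<and> pverts G = V1 \<union> V2 \<and> (\<forall>e\<in>undirected_edges G. card (V1 \<inter> e) = 1)"
proof -
  have "(\<forall>(u, v)\<in>parcs G. u \<in> V1 \<and> v \<in> V2 \<or> u \<in> V2 \<and> v \<in> V1) \<longleftrightarrow>
      (\<forall>e\<in>undirected_edges G. card (V1 \<inter> e) = 1)" if G: "pair_graph G" "pverts G = V1 \<union> V2"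
  proof -
    have "u \<in> V1 \<and> v \<in> V2 \<or> u \<in> V2 \<and> v \<in> V1 \<longleftrightarrow> card (V1 \<inter> {u, v}) = 1" if "(u, v) \<in> parcs G" for u v
    proof -
      have "{u, v} \<in> undirected_edges G" using that by (auto simp: undirected_edges_def)
      then have "{u, v} \<in> all_edges (V1 \<union> V2)" using undirected_edges_subset[OF G(1)] G(2) by auto
      then show ?thesis
        using card_inter_edge_eq_1[of "{u, v}" "V1 \<union> V2" V1] assms by (auto simp: all_edges_def)
    qed
    then show ?thesis unfolding undirected_edges_def by fastforce
  qed
  then show ?thesis using assms unfolding bipartite_with_def by blast
qed

lemma N_bi_eq:
  assumes "1 \<le> r" "1 \<le> s"
  shows "N_bi r s k = card (bip_graphs (Inl ` {1..r} \<union> Inr ` {1..s}) (Inl ` {1..r} :: (nat + nat) set) k)"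
proof -
  let ?V1 = "Inl ` {1..r} :: (nat + nat) set" and ?V2 = "Inr ` {1..s} :: (nat + nat) set"
  have disj: "?V1 \<inter> ?V2 = {}" by auto
  have card: "card (?V1 \<union> ?V2) = r + s"
    using disj by (subst card_Un_disjoint) (auto simp: card_image)
  have "N_bi r s k = card {G :: (nat + nat) pair_pre_digraph.
        pair_graph G \<and> bipartite_with ?V1 ?V2 G \<and>
        Digraph_Component.connected (with_proj G) \<and>
        card (undirected_edges G) + 1 = r + s + k}"
    using assms by (simp add: N_bi_def)
  also have "{G :: (nat + nat) pair_pre_digraph. pair_graph G \<and> bipartite_with ?V1 ?V2 G \<and>
        Digraph_Component.connected (with_proj G) \<and> card (undirected_edges G) + 1 = r + s + k} =
      {G. pair_graph G \<and> pverts G = ?V1 \<union> ?V2 \<and> Digraph_Component.connected (with_proj G) \<and>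
      card (undirected_edges G) + 1 = card (?V1 \<union> ?V2) + k \<and>
      (\<forall>e\<in>undirected_edges G. card (?V1 \<inter> e) = 1)}"
    unfolding card using bipartite_with_iff[OF disj] by blast
  also have "card \<dots> = card {E \<in> conn_graphs (?V1 \<union> ?V2) k. \<forall>e\<in>E. card (?V1 \<inter> e) = 1}"
    using assms by (intro card_pair_graphs) auto
  finally show ?thesis by (simp only: bip_graphs_def)
qed

section \<open>Relabelling and summation over colour classes\<close>

lemma finite_bip_graphs: "finite V \<Longrightarrow> finite (bip_graphs V S k)"
  unfolding bip_graphs_def by (rule finite_subset[OF _ finite_conn_graphs[of V k]]) auto

lemma card_bip_graphs_le:
  assumes V: "finite V" and S: "S \<subseteq> V" and h: "inj_on h V"
  shows "card (bip_graphs V S k) \<le> card (bip_graphs (h ` V) (h ` S) k)"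
proof (rule card_inj_on_le)
  have inj: "inj_on ((`) h) (Pow V)" using h by (rule inj_on_image_Pow)
  have EV: "E \<subseteq> all_edges V" "E \<subseteq> Pow V" if "E \<in> bip_graphs V S k" for E
    using that by (auto simp: bip_graphs_def conn_graphs_def all_edges_def)
  show "inj_on ((`) ((`) h)) (bip_graphs V S k)"
    using inj_on_image_Pow[OF inj] by (rule inj_on_subset) (meson EV(2) PowI subsetI)
  show "finite (bip_graphs (h ` V) (h ` S) k)" using V by (intro finite_bip_graphs) auto
  show "(`) ((`) h) ` bip_graphs V S k \<subseteq> bip_graphs (h ` V) (h ` S) k"
  proof clarify
    fix E assume E: "E \<in> bip_graphs V S k"
    let ?E = "(`) h ` E"
    have eV: "e \<subseteq> V" "card e = 2" if "e \<in> E" for e using that EV(1)[OF E] by (auto simp: all_edges_def)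
    have sub: "?E \<subseteq> all_edges (h ` V)"
      using eV h by (auto simp: all_edges_def card_image inj_on_subset)
    have card: "card ?E = card E" using inj EV(2)[OF E] by (intro card_image) (rule inj_on_subset)
    have "card (h ` V) = card V" using h by (rule card_image)
    moreover have "card E + 1 = card V + k" using E by (auto simp: bip_graphs_def conn_graphs_def)
    ultimately have count: "card ?E + 1 = card (h ` V) + k" using card by simp
    have conn: "Z = {} \<or> Z = h ` V" if Z: "Z \<subseteq> h ` V" "uncut Z ?E" for Z
    proof -
      let ?Z = "{v \<in> V. h v \<in> Z}"
      have "e \<subseteq> ?Z \<or> e \<inter> ?Z = {}" if e: "e \<in> E" for e
      proof -
        have "h ` e \<subseteq> Z \<or> h ` e \<inter> Z = {}" using Z(2) e by (auto simp: uncut_def)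
        then show ?thesis using eV(1)[OF e] by blast
      qed
      then have "uncut ?Z E" by (auto simp: uncut_def)
      moreover have "?Z \<subseteq> V" by auto
      ultimately have "?Z = {} \<or> ?Z = V" using E unfolding bip_graphs_def conn_graphs_def by blast
      then show ?thesis using Z(1) by blast
    qed
    have "card (h ` S \<inter> h ` e) = 1" if e: "e \<in> E" for e
    proof -
      have "h ` S \<inter> h ` e = h ` (S \<inter> e)" using inj_on_image_Int[OF h S eV(1)[OF e]] by simp
      then have "card (h ` S \<inter> h ` e) = card (S \<inter> e)"
        using h S by (metis card_image inf.coboundedI1 inj_on_subset)
      then show ?thesis using E e by (auto simp: bip_graphs_def)
    qed
    then show "?E \<in> bip_graphs (h ` V) (h ` S) k"
      using sub count conn by (auto simp: bip_graphs_def conn_graphs_def)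
  qed
qed

lemma card_bip_graphs_image:
  assumes V: "finite V" and S: "S \<subseteq> V" and h: "inj_on h V"
  shows "card (bip_graphs (h ` V) (h ` S) k) = card (bip_graphs V S k)"
proof (rule antisym)
  have "card (bip_graphs (h ` V) (h ` S) k) \<le>
      card (bip_graphs (inv_into V h ` h ` V) (inv_into V h ` h ` S) k)"
    using V S by (intro card_bip_graphs_le inj_on_inv_into) auto
  then show "card (bip_graphs (h ` V) (h ` S) k) \<le> card (bip_graphs V S k)"
    using h S by (simp add: inv_into_image_cancel)
qed (rule card_bip_graphs_le[OF V S h])

text \<open>An empty colour class leaves no edges, so two or more vertices cannot be connected. This
  matches the convention of \<open>N_bi\<close> for \<open>r * s = 0\<close>.\<close>

lemma bip_graphs_trivial:
  assumes V: "finite V" "2 \<le> card V" and S: "S = {} \<or> S = V"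
  shows "bip_graphs V S k = {}"
proof -
  have False if E: "E \<in> bip_graphs V S k" for E
  proof -
    have EV: "E \<subseteq> all_edges V" using E by (auto simp: bip_graphs_def conn_graphs_def)
    have "card (S \<inter> e) \<noteq> 1" if "e \<in> E" for e
    proof -
      have "e \<subseteq> V" "card e = 2" using that EV by (auto simp: all_edges_def)
      then show ?thesis using S by (auto simp: Int_absorb1)
    qed
    then have "E = {}" using E by (auto simp: bip_graphs_def)
    obtain v where v: "v \<in> V" using V by fastforce
    have "uncut {v} E" by (simp add: uncut_def \<open>E = {}\<close>)
    then have "{v} = V" using E v unfolding bip_graphs_def conn_graphs_def by blast
    then have "card V = 1" by auto
    then show False using V(2) by simp
  qed
  then show ?thesis by auto
qed

lemma card_bip_graphs_eq_N_bi:
  assumes V: "finite V" "2 \<le> card V" and S: "S \<subseteq> V"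
  shows "card (bip_graphs V S k) = N_bi (card S) (card V - card S) k"
proof (cases "S = {} \<or> S = V")
  case True
  then have "N_bi (card S) (card V - card S) k = 0" using V(2) by (auto simp: N_bi_def)
  then show ?thesis using bip_graphs_trivial[OF V True] by simp
next
  case False
  have fS: "finite S" "finite (V - S)" using V S finite_subset by auto
  have card: "card (V - S) = card V - card S" using fS S by (simp add: card_Diff_subset)
  obtain f g where f: "bij_betw f {1..card S} S" and g: "bij_betw g {1..card (V - S)} (V - S)"
    using fS by (metis ex_bij_betw_nat_finite_1)
  let ?W1 = "Inl ` {1..card S} :: (nat + nat) set"
  let ?W = "?W1 \<union> Inr ` {1..card (V - S)}"
  define h where "h = case_sum f g"
  have h1: "h ` ?W1 = S" using f by (auto simp: h_def image_image bij_betw_def)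
  have h2: "h ` Inr ` {1..card (V - S)} = V - S" using g by (auto simp: h_def image_image bij_betw_def)
  have inj: "inj_on h ?W"
  proof -
    have "h \<circ> Inl = f" "h \<circ> Inr = g" by (auto simp: h_def)
    then have "inj_on (h \<circ> Inl) {1..card S}" "inj_on (h \<circ> Inr) {1..card (V - S)}"
      using f g by (simp_all add: bij_betw_def)
    then have "inj_on h ?W1" "inj_on h (Inr ` {1..card (V - S)})" by (auto intro: inj_on_imageI)
    moreover have "h ` (?W1 - Inr ` {1..card (V - S)}) \<inter> h ` (Inr ` {1..card (V - S)} - ?W1) = {}"
      using h1 h2 by blast
    ultimately show ?thesis unfolding inj_on_Un by blast
  qed
  have hW: "h ` ?W = V" using h1 h2 S by (auto simp: image_Un)
  have "card (bip_graphs V S k) = card (bip_graphs (h ` ?W) (h ` ?W1) k)"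
    by (simp only: hW h1)
  also have "\<dots> = card (bip_graphs ?W ?W1 k)" using inj by (intro card_bip_graphs_image) auto
  also have "\<dots> = N_bi (card S) (card (V - S)) k"
  proof (rule N_bi_eq[symmetric])
    have "S \<noteq> {}" "V - S \<noteq> {}" using False S by auto
    then show "1 \<le> card S" "1 \<le> card (V - S)"
      using fS by (simp_all add: Suc_le_eq card_gt_0_iff)
  qed
  finally show ?thesis using card by simp
qed

text \<open>The binomial coefficient counts the choices of the first class \<open>S\<close> among
  the labels; exchanging sums then counts the proper 2-colourings of each connected graph.\<close>

lemma N_bi_total_eq:
  assumes n: "2 \<le> n"
  shows "N_bi_total n k =
    (\<Sum>E\<in>conn_graphs {1..n} k. card {S \<in> Pow {1..n}. \<forall>e\<in>E. card (S \<inter> e) = 1})"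
proof -
  let ?V = "{1..n}" let ?G = "conn_graphs ?V k"
  have fG: "finite ?G" by (intro finite_conn_graphs) simp
  have "N_bi_total n k = (\<Sum>r\<le>n. (n choose r) * N_bi r (n - r) k)"
    unfolding N_bi_total_def
    by (rule sum.reindex_bij_witness[where i = "\<lambda>r. (r, n - r)" and j = fst]) auto
  also have "\<dots> = (\<Sum>r\<le>n. \<Sum>S\<in>{S. S \<in> Pow ?V \<and> card S = r}. card (bip_graphs ?V S k))"
  proof (rule sum.cong[OF refl])
    fix r assume "r \<in> {..n}"
    have "card {S. S \<in> Pow ?V \<and> card S = r} = n choose r" using n_subsets[of ?V r] by simp
    then show "(n choose r) * N_bi r (n - r) k =
        (\<Sum>S\<in>{S. S \<in> Pow ?V \<and> card S = r}. card (bip_graphs ?V S k))"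
      using n card_bip_graphs_eq_N_bi[of ?V _ k] by simp
  qed
  also have "\<dots> = (\<Sum>S\<in>Pow ?V. card (bip_graphs ?V S k))"
  proof (rule sum.group)
    show "card ` Pow ?V \<subseteq> {..n}" using card_mono[of ?V] by fastforce
  qed auto
  also have "\<dots> = (\<Sum>S\<in>Pow ?V. \<Sum>E\<in>?G. if \<forall>e\<in>E. card (S \<inter> e) = 1 then 1 else 0)"
    using fG by (simp add: bip_graphs_def sum.If_cases Collect_conj_eq)
  also have "\<dots> = (\<Sum>E\<in>?G. \<Sum>S\<in>Pow ?V. if \<forall>e\<in>E. card (S \<inter> e) = 1 then 1 else 0)"
    by (rule sum.swap)
  also have "\<dots> = (\<Sum>E\<in>?G. card {S \<in> Pow ?V. \<forall>e\<in>E. card (S \<inter> e) = 1})"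
    by (simp only: card_eq_sum sum.inter_filter finite_Pow_iff finite_atLeastAtMost)
  finally show ?thesis .
qed

text \<open>A spanning star at 1 with \<open>k\<close> more edges at 2. It makes the normalisation
  by the number of graphs legitimate from \<open>k + 2\<close> on.\<close>

lemma conn_graphs_nonempty:
  assumes n: "k + 2 \<le> n"
  shows "conn_graphs {1..n} k \<noteq> {}"
proof -
  let ?A = "(\<lambda>j. {1, j}) ` {2..n}" and ?B = "(\<lambda>j. {2, j}) ` {3..k + 2}"
  have "card ?A = n - 1" by (subst card_image) (auto simp: inj_on_def doubleton_eq_iff)
  moreover have "card ?B = k" by (subst card_image) (auto simp: inj_on_def doubleton_eq_iff)
  moreover have "?A \<inter> ?B = {}" by (auto simp: doubleton_eq_iff)
  ultimately have "card (?A \<union> ?B) = n - 1 + k" by (simp add: card_Un_disjoint)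
  moreover have "?A \<union> ?B \<subseteq> all_edges {1..n}" using n by (auto simp: all_edges_def)
  moreover have "{1..n} \<subseteq> S \<or> {1..n} \<inter> S = {}" if S: "uncut S (?A \<union> ?B)" for S
  proof -
    have "j \<in> S \<longleftrightarrow> 1 \<in> S" if "j \<in> {1..n}" for j
    proof (cases "j = 1")
      case False
      then have "{1, j} \<in> ?A \<union> ?B" using that by auto
      then show ?thesis using uncutD[OF S] by blast
    qed simp
    then show ?thesis by blast
  qed
  ultimately have "?A \<union> ?B \<in> conn_graphs {1..n} k" using n by (intro conn_graphsI) auto
  then show ?thesis by blast
qed

section \<open>The asymptotic equivalence\<close>

lemma N_bi_total_alternating:
  fixes n k m :: nat
  assumes n: "2 \<le> n" and m: "card (all_edges {1..n}) < m"
  shows "2 ^ k * real (N_bi_total n k) =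
    2 * (\<Sum>l<m. (-1) ^ l * real (card (marked {1..n} k l)))"
proof -
  let ?V = "{1..n}" let ?G = "conn_graphs ?V k"
  have "2 ^ k * real (N_bi_total n k) =
      (\<Sum>E\<in>?G. 2 ^ k * real (card {S \<in> Pow ?V. \<forall>e\<in>E. card (S \<inter> e) = 1}))"
    unfolding N_bi_total_eq[OF n] of_nat_sum by (rule sum_distrib_left)
  also have "\<dots> = (\<Sum>E\<in>?G. 2 * (\<Sum>c\<in>even_subs E. (-1) ^ card c))"
    by (intro sum.cong refl card_bipartitions) auto
  also have "\<dots> = 2 * (\<Sum>E\<in>?G. \<Sum>c\<in>even_subs E. (-1) ^ card c)"
    by (rule sum_distrib_left[symmetric])
  also have "(\<Sum>E\<in>?G. \<Sum>c\<in>even_subs E. (-1::real) ^ card c) =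
      (\<Sum>l<m. \<Sum>p\<in>marked ?V k l. (-1) ^ card (snd p))"
    using sum_marked[of ?V m "\<lambda>p. (-1::real) ^ card (snd p)" k] m by simp
  also have "\<dots> = (\<Sum>l<m. (-1) ^ l * real (card (marked ?V k l)))"
  proof (rule sum.cong[OF refl])
    fix l
    have "(\<Sum>p\<in>marked ?V k l. (-1::real) ^ card (snd p)) = (\<Sum>p\<in>marked ?V k l. (-1) ^ l)"
      by (rule sum.cong) (auto simp: marked_def)
    then show "(\<Sum>p\<in>marked ?V k l. (-1::real) ^ card (snd p)) =
        (-1) ^ l * real (card (marked ?V k l))" by (simp add: mult.commute)
  qed
  finally show ?thesis .
qed

lemma card_marked_0:
  assumes V: "finite V"
  shows "card (marked V k 0) = card (conn_graphs V k)"
proof -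
  have "c = {}" if "E \<in> conn_graphs V k" "c \<in> even_subs E" "card c = 0" for E c
  proof -
    have "finite E" using finite_edges[OF V] that(1) by (auto simp: conn_graphs_def)
    then have "finite c" using that(2) finite_subset by (auto simp: even_subs_def)
    then show ?thesis using that(3) by simp
  qed
  moreover have "{} \<in> even_subs E" for E :: "'a set set" by (simp add: even_subs_def deg_def)
  ultimately have "marked V k 0 = conn_graphs V k \<times> {{}}" by (auto simp: marked_def)
  then show ?thesis by (simp add: card_cartesian_product)
qed

lemma sum_card_marked_le:
  assumes V: "finite V" "V \<noteq> {}"
  shows "(\<Sum>l<m. real (card (marked V k l))) \<le> 2 ^ k * real (card (conn_graphs V k))"
proof -
  have "(\<Sum>l<m. real (card (marked V k l))) = (\<Sum>l<m. \<Sum>p\<in>marked V k l. 1)" by simp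
  also have "\<dots> \<le> (\<Sum>E\<in>conn_graphs V k. \<Sum>c\<in>even_subs E. 1)"
    by (intro sum_marked_le V) simp
  also have "\<dots> = (\<Sum>E\<in>conn_graphs V k. 2 ^ k)"
    using card_even_subs[OF V] by (intro sum.cong refl) (simp add: numeral_power_eq_of_nat_cancel_iff)
  finally show ?thesis by (simp add: mult.commute)
qed

lemma sum_marked_nonbridges_le:
  assumes V: "finite V" "V \<noteq> {}"
  shows "(\<Sum>l<m. \<Sum>(E, c)\<in>marked V k l. real (card (nonbridges E) + k + 1)) \<le>
    2 ^ k * (sqrt (card V) * real (k * (k + 1) + 3 * k + 4 * 2 ^ k + 1) + real (k + 1)) *
      real (card (conn_graphs V k))"
proof -
  let ?G = "conn_graphs V k"
  have "(\<Sum>l<m. \<Sum>(E, c)\<in>marked V k l. real (card (nonbridges E) + k + 1)) \<le>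
      (\<Sum>E\<in>?G. \<Sum>c\<in>even_subs E. real (card (nonbridges E) + k + 1))"
    using sum_marked_le[OF V(1), of "\<lambda>(E, c). real (card (nonbridges E) + k + 1)" k m]
    by (simp add: case_prod_unfold)
  also have "\<dots> = (\<Sum>E\<in>?G. 2 ^ k * (real (card (nonbridges E)) + real (k + 1)))"
    using card_even_subs[OF V] by (intro sum.cong refl) simp
  also have "\<dots> = 2 ^ k * ((\<Sum>E\<in>?G. real (card (nonbridges E))) + real (k + 1) * real (card ?G))"
    by (simp only: sum_distrib_left[symmetric] sum.distrib sum_constant mult.commute)
  also have "\<dots> \<le> 2 ^ k * (sqrt (card V) * real (k * (k + 1) + 3 * k + 4 * 2 ^ k + 1) *
      real (card ?G) + real (k + 1) * real (card ?G))"
    by (intro mult_left_mono add_right_mono sum_card_nonbridges V) simp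
  finally show ?thesis by (simp only: distrib_right mult.assoc)
qed

theorem theorem1p5:
  fixes k :: nat
  shows "(\<lambda>n. real (N_bi_total n k) / (1 / 2 powi (int k - 1) * real (N n k))) \<longlonglongrightarrow> 1"
proof -
  define g where "g n = real (card (conn_graphs {1..n} k))" for n :: nat
  define a where "a n l = real (card (marked {1..n} k l)) / g n" for n l :: nat
  define h where "h n l = (\<Sum>(E, c)\<in>marked {1..n} k l. real (card (nonbridges E) + k + 1))" for n l :: nat
  \<comment> \<open>Division by \<open>n * g n\<close> brings the recursion to normalised form;
    \<open>\<epsilon>\<close> is of order \<open>1 / sqrt n\<close>, as the mean number of
    nonbridges is \<open>O(sqrt n)\<close>.\<close>
  define \<mu> where "\<mu> n l = h n l / (n * g n)" for n l :: nat
  define C where "C = real (k * (k + 1) + 3 * k + 4 * 2 ^ k + 1)"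
  define \<epsilon> where "\<epsilon> n = 2 ^ k * (sqrt n * C + real (k + 1)) / n" for n :: nat
  \<comment> \<open>One more than the number of possible edges, so no even subgraph has length
    \<open>D n\<close> or more.\<close>
  define D where "D n = card (all_edges {1..n}) + 1" for n :: nat
  have g: "0 < g n" if "k + 2 \<le> n" for n
    using conn_graphs_nonempty[OF that] finite_conn_graphs[of "{1..n}" k]
    by (simp add: g_def card_gt_0_iff)
  have "(\<lambda>n. \<Sum>l=1..<D n. (-1) ^ l * a n l) \<longlonglongrightarrow> 0"
  proof (rule alternating_sum_tendsto_0[where M = "k + 2" and \<mu> = \<mu> and \<epsilon> = \<epsilon> and
        K = "2 ^ k" and B = "real (3 * k + 4 * 2 ^ k)"])
    show "0 \<le> a n l" "0 \<le> \<mu> n l" for n l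
      by (auto simp: a_def \<mu>_def h_def g_def intro!: divide_nonneg_nonneg sum_nonneg)
    fix n l m :: nat assume n: "k + 2 \<le> n"
    then have V: "finite {1..n}" "{1..n} \<noteq> {}" and npos: "0 < real n" by auto
    note gn = g[OF n]
    show "(\<Sum>l<m. a n l) \<le> 2 ^ k"
      using sum_card_marked_le[OF V, of k m] gn
      by (simp add: a_def g_def sum_divide_distrib[symmetric] divide_le_eq)
    have "(\<Sum>l<m. h n l) \<le> 2 ^ k * (sqrt n * C + real (k + 1)) * g n"
      using sum_marked_nonbridges_le[OF V, of k m] by (simp add: h_def g_def C_def)
    then have "(\<Sum>l<m. h n l) / (n * g n) \<le> (2 ^ k * (sqrt n * C + real (k + 1)) * g n) / (n * g n)"
      using gn by (intro divide_right_mono) auto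
    then show "(\<Sum>l<m. \<mu> n l) \<le> \<epsilon> n"
      using gn by (simp add: \<mu>_def \<epsilon>_def sum_divide_distrib[symmetric])
    have ng: "0 < n * g n" using gn npos by simp
    have scale: "real (card {1..n}) = n" "real (card (marked {1..n} k l)) = g n * a n l"
        "h n l = n * g n * \<mu> n l" for l
      using gn npos by (simp_all add: a_def \<mu>_def)
    note r = marked_recursion[OF V, of l k, folded h_def, unfolded scale]
    have "(n * g n) * (l * (a n l - \<mu> n l)) \<le> (n * g n) * (Suc l * a n (Suc l))"
      using r(1) by (simp add: algebra_simps)
    then show "l * (a n l - \<mu> n l) \<le> Suc l * a n (Suc l)"
      using ng by (simp only: mult_le_cancel_left_pos)
    have "(n * g n) * (Suc l * a n (Suc l)) \<le>
        (n * g n) * (l * (a n l + \<mu> n l) + real (3 * k + 4 * 2 ^ k) * a n (Suc l))"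
      using r(2) by (simp add: algebra_simps)
    then show "Suc l * a n (Suc l) \<le> l * (a n l + \<mu> n l) + real (3 * k + 4 * 2 ^ k) * a n (Suc l)"
      using ng by (simp only: mult_le_cancel_left_pos)
    assume l: "D n \<le> l"
    have "marked {1..n} k l = {}"
    proof -
      have "card c < l" if "E \<in> conn_graphs {1..n} k" "c \<in> even_subs E" for E c
      proof -
        have "c \<subseteq> all_edges {1..n}" using that by (auto simp: conn_graphs_def even_subs_def)
        then have "card c \<le> card (all_edges {1..n})" using finite_all_edges by (intro card_mono) auto
        then show ?thesis using l by (simp add: D_def)
      qed
      then show ?thesis by (fastforce simp: marked_def)
    qed
    then show "a n l = 0" by (simp add: a_def)
  next
    have "(\<lambda>n. 2 ^ k * (C * (1 / sqrt (real n)) + real (k + 1) * (1 / real n))) \<longlonglongrightarrow>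
        2 ^ k * (C * 0 + real (k + 1) * 0)"
      by (intro tendsto_intros lim_1_over_n tendsto_divide_0[OF tendsto_const]
          filterlim_at_top_imp_at_infinity filterlim_compose[OF sqrt_at_top filterlim_real_sequentially])
    moreover have "\<epsilon> n = 2 ^ k * (C * (1 / sqrt (real n)) + real (k + 1) * (1 / real n))" for n
    proof -
      have "\<epsilon> n = 2 ^ k * (C * (sqrt (real n) / n) + real (k + 1) * (1 / real n))"
        \<comment> \<open>At \<open>n = 0\<close> both sides are zero, since division by zero yields
          zero.\<close>
        by (cases "n = 0") (simp_all add: \<epsilon>_def field_simps)
      also have "sqrt (real n) / n = 1 / sqrt (real n)"
        by (simp add: sqrt_divide_self_eq inverse_eq_divide)
      finally show ?thesis .
    qed
    then have "\<epsilon> = (\<lambda>n. 2 ^ k * (C * (1 / sqrt (real n)) + real (k + 1) * (1 / real n)))" ..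
    ultimately show "\<epsilon> \<longlonglongrightarrow> 0" by (simp only: mult_zero_right add_0_right)
  qed simp
  then have "(\<lambda>n. 1 + (\<Sum>l=1..<D n. (-1) ^ l * a n l)) \<longlonglongrightarrow> 1 + 0"
    by (intro tendsto_add tendsto_const)
  moreover have "eventually (\<lambda>n. 1 + (\<Sum>l=1..<D n. (-1) ^ l * a n l) =
      real (N_bi_total n k) / (1 / 2 powi (int k - 1) * real (N n k))) sequentially"
    using eventually_ge_at_top[of "k + 2"]
  proof eventually_elim
    case (elim n)
    have gn: "g n \<noteq> 0" using g[OF elim] by simp
    have "2 ^ k * real (N_bi_total n k) = 2 * (\<Sum>l<D n. (-1) ^ l * real (card (marked {1..n} k l)))"
      using elim by (intro N_bi_total_alternating) (auto simp: D_def)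
    then have "2 ^ k * real (N_bi_total n k) / (2 * g n) =
        (\<Sum>l<D n. (-1) ^ l * real (card (marked {1..n} k l))) / g n" by simp
    also have "\<dots> = (\<Sum>l<D n. (-1) ^ l * a n l)"
      by (simp add: a_def sum_divide_distrib)
    also have "\<dots> = (\<Sum>l=0..<D n. (-1) ^ l * a n l)" by (simp add: lessThan_atLeast0)
    also have "\<dots> = (-1) ^ 0 * a n 0 + (\<Sum>l=Suc 0..<D n. (-1) ^ l * a n l)"
      by (rule sum.atLeast_Suc_lessThan) (simp add: D_def)
    also have "a n 0 = 1" using gn card_marked_0[of "{1..n}" k] by (simp add: a_def g_def)
    finally have "1 + (\<Sum>l=1..<D n. (-1) ^ l * a n l) = 2 ^ k * real (N_bi_total n k) / (2 * g n)"
      by simp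
    moreover have "(2::real) powi (int k - 1) = 2 ^ k / 2" by (simp add: power_int_diff)
    moreover have "real (N n k) = g n" using elim by (simp add: N_eq g_def)
    moreover have "real (N_bi_total n k) / (1 / (2 ^ k / 2) * g n) =
        2 ^ k * real (N_bi_total n k) / (2 * g n)" by simp
    ultimately show ?case by (simp only:)
  qed
  ultimately show ?thesis by (simp add: tendsto_cong)
qed

end
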